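(* Let $p\in\mathbb{T}\mathbb{R}[x]$. Then there exists a polynomial $P\in\mathbb{R}[[t^{\mathbb{R}}]][x]$ with $v_{\mathbb{R}}(P)=p$ (coefficientwise) such that for each edge $\sigma$ of the Newton polygon of $P$, with slope $-|a|$ where $a\in\mathbb{T}\mathbb{R}$ has sign $+1$, $P$ has exactly $\operatorname{mult}_a(p(x))$ (respectively $\operatorname{mult}_a(p(-x))$) roots in $\mathbb{C}[[t^{\mathbb{R}}]]$, counted with multiplicity, of valuation $|a|$ whose leading term is real and positive (respectively real and negative).
   Context: For $k=\mathbb{R},\mathbb{C}$, $k[[t^{\mathbb{R}}]]$ is the field of Hahn series $\sum_{\gamma\in I}a_\gamma t^\gamma$ ($a_\gamma\in k$, $I\subset\mathbb{R}$ well-ordered). For nonzero such series with $\gamma_0=\min\{\gamma:a_\gamma\ne0\}$, the valuation is $\gamma_0$, the leading term is $a_{\gamma_0}t^{\gamma_0}$, and for real series $v_{\mathbb{R}}(\sum a_\gamma t^\gamma)=(\operatorname{sign}(a_{\gamma_0}),\gamma_0)$, $v_{\mathbb{R}}(0)=\infty$. The signed tropical hyperfield $\mathbb{T}\mathbb{R}$ has underlying set $(\{\pm1\}\times\mathbb{R})\cup\{\infty\}$, zero $\infty$, unit $(+1,0)$, multiplication $(s,r)(s',r')=(ss',r+r')$, $\infty\cdot x=\infty$; for $x=(s,r)$, $|x|=r$, $-x=(-s,r)$. Hyperaddition: $x\boxplus\infty=\{x\}$, and $(s,r)\boxplus(s',r')$ equals $\{(s,r)\}$ if $r<r'$, $\{(s',r')\}$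 if $r'<r$, $\{(s,r)\}$ if $r=r'$, $s=s'$, and $\{(\pm1,t):t\ge r\}\cup\{\infty\}$ if $r=r'$, $s=-s'$; iterated sums are unions as usual. The Newton polygon of $P=\sum c_ix^i$ is the lower convex hull of $\{(i,v(c_i))\}$; edges are bounded edges. For $q=\sum c_ix^i$ over $\mathbb{T}\mathbb{R}$, $q(-x)=\sum (-1)^ic_ix^i$ (with $-1=(-1,0)$). For a polynomial $q=\sum_{i=0}^n c_ix^i$ over $\mathbb{T}\mathbb{R}$ and $b\in\mathbb{T}\mathbb{R}$: $b$ is a root if $\infty\in\boxplus_i c_ib^i$; $q\in(x-b)s$ with $s=\sum_{i=0}^{n-1}d_ix^i$ means $c_0=-bd_0$, $c_i\in(-bd_i)\boxplus d_{i-1}$ for $1\le i\le n-1$, $c_n=d_{n-1}$; and $\operatorname{mult}_b(q)=0$ if $b$ is not a root, otherwise $1+\max\{\operatorname{mult}_b(s):q\in(x-b)s\}$. *)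

theory Defs
  imports Complex_Main
begin

datatype sgn = Pos | Neg

fun sgn_neg :: "sgn \<Rightarrow> sgn" where
  "sgn_neg Pos = Neg" | "sgn_neg Neg = Pos"

fun sgn_mul :: "sgn \<Rightarrow> sgn \<Rightarrow> sgn" where
  "sgn_mul Pos s = s" | "sgn_mul Neg s = sgn_neg s"

text \<open>TInf is the zero element infinity; TFin s r is the pair (s, r).\<close>
datatype trh = TInf | TFin sgn real

fun tmul :: "trh \<Rightarrow> trh \<Rightarrow> trh" where
  "tmul TInf y = TInf"
| "tmul x TInf = TInf"
| "tmul (TFin s r) (TFin s' r') = TFin (sgn_mul s s') (r + r')"

fun tneg :: "trh \<Rightarrow> trh" where
  "tneg TInf = TInf"
| "tneg (TFin s r) = TFin (sgn_neg s) r"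

definition tone :: trh where "tone = TFin Pos 0"

fun tpow :: "trh \<Rightarrow> nat \<Rightarrow> trh" where
  "tpow b 0 = tone"
| "tpow b (Suc n) = tmul b (tpow b n)"

fun hadd :: "trh \<Rightarrow> trh \<Rightarrow> trh set" where
  "hadd TInf y = {y}"
| "hadd x TInf = {x}"
| "hadd (TFin s r) (TFin s' r') =
     (if r < r' then {TFin s r}
      else if r' < r then {TFin s' r'}
      else if s = s' then {TFin s r}
      else {TFin u t | u t. r \<le> t} \<union> {TInf})"

fun hsum :: "trh list \<Rightarrow> trh set" where
  "hsum [] = {TInf}"
| "hsum (x # xs) = (\<Union>y\<in>hsum xs. hadd x y)"

definition troot :: "trh list \<Rightarrow> trh \<Rightarrow> bool" where
  "troot q b \<longleftrightarrow> TInf \<in> hsum (map (\<lambda>i. tmul (q ! i) (tpow b i)) [0..<length q])"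

text \<open>q \<in> (x - b) s, with q = [c_0..c_n], s = [d_0..d_(n-1)].\<close>
definition tdivides :: "trh list \<Rightarrow> trh \<Rightarrow> trh list \<Rightarrow> bool" where
  "tdivides q b s \<longleftrightarrow>
     1 \<le> length s \<and> length q = length s + 1 \<and>
     q ! 0 = tneg (tmul b (s ! 0)) \<and>
     (\<forall>i. 1 \<le> i \<and> i \<le> length s - 1 \<longrightarrow> q ! i \<in> hadd (tneg (tmul b (s ! i))) (s ! (i - 1))) \<and>
     q ! (length s) = s ! (length s - 1)"

inductive tmult_ge :: "trh list \<Rightarrow> trh \<Rightarrow> nat \<Rightarrow> bool" where
  zero: "tmult_ge q b 0"
| one: "troot q b \<Longrightarrow> tmult_ge q b (Suc 0)"
| step: "troot q b \<Longrightarrow> tdivides q b s \<Longrightarrow> tmult_ge s b m \<Longrightarrow> tmult_ge q b (Suc m)"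

definition tmult :: "trh list \<Rightarrow> trh \<Rightarrow> nat" where
  "tmult q b = Max {m. tmult_ge q b m}"

definition tneg_var :: "trh list \<Rightarrow> trh list" where
  "tneg_var q = map (\<lambda>i. if even i then q ! i else tneg (q ! i)) [0..<length q]"

section \<open>Hahn series k[[t^R]] as functions real => k with well-ordered support\<close>

definition hahn :: "(real \<Rightarrow> 'a::zero) \<Rightarrow> bool" where
  "hahn f \<longleftrightarrow> (\<forall>S. S \<subseteq> {\<gamma>. f \<gamma> \<noteq> 0} \<longrightarrow> S \<noteq> {} \<longrightarrow> (\<exists>m\<in>S. \<forall>y\<in>S. m \<le> y))"

definition hval :: "(real \<Rightarrow> 'a::zero) \<Rightarrow> real" where
  "hval f = (LEAST \<gamma>. f \<gamma> \<noteq> 0)"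

definition vR :: "(real \<Rightarrow> real) \<Rightarrow> trh" where
  "vR f = (if f = (\<lambda>_. 0) then TInf
           else TFin (if f (hval f) > 0 then Pos else Neg) (hval f))"

definition hmul :: "(real \<Rightarrow> 'a::comm_ring_1) \<Rightarrow> (real \<Rightarrow> 'a) \<Rightarrow> real \<Rightarrow> 'a" where
  "hmul f g = (\<lambda>\<gamma>. \<Sum>(\<alpha>, \<beta>) \<in> {(\<alpha>, \<beta>). \<alpha> + \<beta> = \<gamma> \<and> f \<alpha> \<noteq> 0 \<and> g \<beta> \<noteq> 0}. f \<alpha> * g \<beta>)"

definition hone :: "real \<Rightarrow> 'a::comm_ring_1" where
  "hone = (\<lambda>\<gamma>. if \<gamma> = 0 then 1 else 0)"

definition cplx :: "(real \<Rightarrow> real) \<Rightarrow> real \<Rightarrow> complex" where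
  "cplx f = (\<lambda>\<gamma>. complex_of_real (f \<gamma>))"

definition pcoeff :: "(real \<Rightarrow> 'a::zero) list \<Rightarrow> nat \<Rightarrow> real \<Rightarrow> 'a" where
  "pcoeff cs k = (if k < length cs then cs ! k else (\<lambda>_. 0))"

definition lin_mult :: "(real \<Rightarrow> 'a::comm_ring_1) \<Rightarrow> (real \<Rightarrow> 'a) list \<Rightarrow> (real \<Rightarrow> 'a) list" where
  "lin_mult r cs = map (\<lambda>k. \<lambda>\<gamma>. (if k = 0 then 0 else pcoeff cs (k - 1) \<gamma>) - hmul r (pcoeff cs k) \<gamma>)
                       [0..<Suc (length cs)]"

definition linprod :: "(real \<Rightarrow> 'a::comm_ring_1) list \<Rightarrow> (real \<Rightarrow> 'a) list" where
  "linprod rs = foldr lin_mult rs [hone]"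

text \<open>Q = c * prod_{r in rs} (x - r) (coefficientwise, ignoring trailing zeros).\<close>
definition splits_as :: "(real \<Rightarrow> 'a::comm_ring_1) list \<Rightarrow> (real \<Rightarrow> 'a) \<Rightarrow> (real \<Rightarrow> 'a) list \<Rightarrow> bool" where
  "splits_as Q c rs \<longleftrightarrow> (\<forall>k. pcoeff Q k = hmul c (pcoeff (linprod rs) k))"

definition lead_root :: "(real \<Rightarrow> complex) \<Rightarrow> real \<Rightarrow> (complex \<Rightarrow> bool) \<Rightarrow> bool" where
  "lead_root r v L \<longleftrightarrow> r \<noteq> (\<lambda>_. 0) \<and> hval r = v \<and> L (r v)"

definition newton_slope :: "(real \<Rightarrow> real) list \<Rightarrow> nat \<Rightarrow> nat \<Rightarrow> real" where
  "newton_slope P i j = (hval (P ! j) - hval (P ! i)) / (real j - real i)"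

text \<open>The segment from (i, v(c_i)) to (j, v(c_j)) is a (bounded) edge of the
  lower convex hull of the points (k, v(c_k)), c_k \<noteq> 0.\<close>
definition newton_edge :: "(real \<Rightarrow> real) list \<Rightarrow> nat \<Rightarrow> nat \<Rightarrow> bool" where
  "newton_edge P i j \<longleftrightarrow>
     i < j \<and> j < length P \<and> P ! i \<noteq> (\<lambda>_. 0) \<and> P ! j \<noteq> (\<lambda>_. 0) \<and>
     (\<forall>k<length P. P ! k \<noteq> (\<lambda>_. 0) \<longrightarrow>
        hval (P ! k) \<ge> hval (P ! i) + newton_slope P i j * (real k - real i)) \<and>
     (\<forall>k<length P. P ! k \<noteq> (\<lambda>_. 0) \<and>
        hval (P ! k) = hval (P ! i) + newton_slope P i j * (real k - real i) \<longrightarrow> i \<le> k \<and> k \<le> j)"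

end

theory Submission
  imports Defs "HOL-Computational_Algebra.Computational_Algebra"
begin

text \<open>
  The coefficients of P are monomials \<open>c\<^sub>k t^(v\<^sub>k)\<close>. On an edge, the number of roots of P with a
  given leading term is the multiplicity of a root of the initial form, which is one of the
  finitely many polynomials \<open>f\<^sub>A = \<Sum>k\<in>A. c\<^sub>k x^k\<close>. Choosing each \<open>c\<^sub>k\<close> generic and tiny compared with its
  predecessors, every \<open>f\<^sub>A\<close> has simple nonzero complex roots and attains Descartes' bound both for
  positive and for negative roots: a new dominated leading term keeps all earlier sign alternations
  and adds one far out whenever its sign is new. On the tropical side the multiplicity is also the
  number of sign changes of the minimal-weight coefficients; Descartes' bound and the tropical upper
  bound are the same lemma about the signs in \<open>q\<^sub>k \<in> - d\<^sub>k \<boxplus> d\<^sub>k\<^sub>-\<^sub>1\<close>. That P splits follows from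
  simplicity of the roots of the initial forms: they lift by a contraction in the series with
  left-finite support, which are complete and already contain all roots.
\<close>

section \<open>Sign changes\<close>

text \<open>Prescribing \<open>vR\<close> fixes only the sign of the leading coefficient c_k, and
  its size matters: with all c_k equal to 1 or -1 the pattern + - + gives 1 - x + x^2, which has no
  real root although the tropical multiplicity is 2, whereas 1 - x/3 + x^2/100 has two positive
  roots. All index sets A are treated at once, so nothing has to be known about which of them come
  from edges, and the same c must serve f_A(x) and f_A(-x). This is possible because each
  requirement on the next coefficient, whose sign is given, holds as soon as its absolute value is
  small enough, and there are finitely many requirements. Simplicity of the roots is used twice: it
  permits the lifting, and it turns the count of roots with multiplicity into the cardinality of a
  set of leading coefficients. One factorisation has to serve all edges, so P is split completely
  instead of edge by edge; the initial form at each slope is then read off from the product of the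
  linear factors.\<close>

fun sign_changes :: "real \<Rightarrow> real list \<Rightarrow> nat" where
  "sign_changes s [] = 0"
| "sign_changes s (x # xs) =
     (if x = 0 then sign_changes s xs
      else (if s * x < 0 then 1 else 0) + sign_changes x xs)"

text \<open>Allows the values 1, -1, 0 read off from tropical coefficients to be compared with real
  coefficients of the same sign.\<close>

lemma sign_changes_sgn_cong:
  "sgn s = sgn s' \<Longrightarrow> map sgn xs = map sgn ys \<Longrightarrow> sign_changes s xs = sign_changes s' ys"
proof (induction xs arbitrary: s s' ys)
  case (Cons x xs)
  then obtain y ys' where ys: "ys = y # ys'" "sgn x = sgn y" "map sgn xs = map sgn ys'"
    by (cases ys) auto
  have "s * x < 0 \<longleftrightarrow> s' * y < 0"
    using Cons.prems(1) ys(2) by (metis sgn_less sgn_mult)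
  moreover have "x = 0 \<longleftrightarrow> y = 0" using ys(2) by (metis sgn_0_0)
  ultimately show ?case
    using Cons.IH[OF Cons.prems(1) ys(3)] Cons.IH[OF ys(2) ys(3)] ys(1) by simp
qed simp

lemma sign_changes_sgn: "sgn s = sgn s' \<Longrightarrow> sign_changes s xs = sign_changes s' xs"
  by (rule sign_changes_sgn_cong) auto

text \<open>The first argument stands for the last nonzero entry seen, with 0 for none. It is
  consulted only at the first nonzero entry of the list, so it affects the count by at most
  one.\<close>

lemma sign_changes_state: "sign_changes s xs \<le> Suc (sign_changes s' xs)"
  by (induction xs arbitrary: s s') auto

lemma sign_changes_0_le: "sign_changes 0 xs \<le> sign_changes s xs"
  by (induction xs) auto

lemma sign_changes_same: "\<forall>x\<in>set xs. 0 \<le> s * x \<Longrightarrow> s \<noteq> 0 \<Longrightarrow> sign_changes s xs = 0"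
proof (induction xs)
  case (Cons x xs)
  have "sgn x = sgn s" if "x \<noteq> 0"
    using that Cons.prems by (auto simp: sgn_if zero_le_mult_iff)
  moreover have "\<not> s * x < 0" using Cons.prems by auto
  ultimately show ?case
    using sign_changes_sgn[of x s xs] Cons by auto
qed auto

lemma sign_changes_pos_ex:
  assumes "sign_changes s xs > 0" "s = 0 \<or> s \<in> set xs"
  shows "(\<exists>x\<in>set xs. x > 0) \<and> (\<exists>x\<in>set xs. x < 0)"
proof (rule ccontr)
  assume *: "\<not> ?thesis"
  have "sign_changes s xs = 0" if "\<forall>x\<in>set xs. 0 \<le> x" "0 \<le> s" for s
    using that
  proof (induction xs arbitrary: s)
    case (Cons x xs)
    then have "0 \<le> s * x" by simp
    then show ?case using Cons by (simp add: not_less[symmetric])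
  qed simp
  moreover have "sign_changes s xs = 0" if "\<forall>x\<in>set xs. x \<le> 0" "s \<le> 0" for s
    using that
  proof (induction xs arbitrary: s)
    case (Cons x xs)
    then have "0 \<le> s * x" by (simp add: mult_nonpos_nonpos)
    then show ?case using Cons by (simp add: not_less[symmetric])
  qed simp
  moreover have "(\<forall>x\<in>set xs. 0 \<le> x) \<or> (\<forall>x\<in>set xs. x \<le> 0)"
    using * by (meson not_le)
  ultimately show False using assms by fastforce
qed

definition last_nz :: "real \<Rightarrow> real list \<Rightarrow> real" where
  "last_nz = foldl (\<lambda>s x. if x = 0 then s else x)"

lemma sign_changes_snoc:
  "sign_changes s (xs @ [x]) = sign_changes s xs + (if last_nz s xs * x < 0 then 1 else 0)"
  by (induction xs arbitrary: s) (auto simp: last_nz_def)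

text \<open>The recursion between the coefficients d of a quotient by a linear factor and those of the
  product q; u is the d preceding the list and z the one following it.\<close>
inductive divrel :: "('a \<Rightarrow> 'a \<Rightarrow> 'a \<Rightarrow> bool) \<Rightarrow> 'a \<Rightarrow> 'a \<Rightarrow> 'a list \<Rightarrow> 'a list \<Rightarrow> bool"
  for R z where
  divrel_Nil: "R z u q \<Longrightarrow> divrel R z u [] [q]"
| divrel_Cons: "R d u q \<Longrightarrow> divrel R z d ds qs \<Longrightarrow> divrel R z u (d # ds) (q # qs)"

text \<open>The inductive form suits the inductions on lists; the indexed form connects it with
  \<open>tdivides\<close> and with coefficients of polynomials.\<close>

lemma divrel_iff_nth:
  "divrel R z u ds qs \<longleftrightarrow> length qs = Suc (length ds) \<and>
     (\<forall>i\<le>length ds. R (if i < length ds then ds ! i else z) (if i = 0 then u else ds ! (i - 1)) (qs ! i))"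
proof (induction ds arbitrary: u qs)
  case Nil
  show ?case by (subst divrel.simps) (auto simp: length_Suc_conv)
next
  case (Cons d ds)
  show ?case
  proof (cases qs)
    case Nil
    then show ?thesis by (auto elim: divrel.cases)
  next
    case (Cons q qs')
    have "divrel R z u (d # ds) (q # qs') \<longleftrightarrow> R d u q \<and> divrel R z d ds qs'"
      by (auto elim: divrel.cases intro: divrel.intros)
    also have "\<dots> \<longleftrightarrow> length (q # qs') = Suc (length (d # ds)) \<and>
     (\<forall>i\<le>length (d # ds). R (if i < length (d # ds) then (d # ds) ! i else z)
        (if i = 0 then u else (d # ds) ! (i - 1)) ((q # qs') ! i))"
    proof -
      have "(\<forall>i\<le>Suc n. P i) \<longleftrightarrow> P 0 \<and> (\<forall>i\<le>n. P (Suc i))" for P and n :: nat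
        using less_Suc_eq_0_disj by (auto simp: less_Suc_eq_le[symmetric])
      then show ?thesis unfolding Cons.IH by (auto simp: nth_Cons')
    qed
    finally show ?thesis using Cons by simp
  qed
qed

text \<open>Addition in the hyperfield of signs, except that a sum of two zeros is left unconstrained.\<close>
definition sadd :: "real \<Rightarrow> real \<Rightarrow> real \<Rightarrow> bool" where
  "sadd a b q \<longleftrightarrow> (0 \<le> a \<and> 0 \<le> b \<and> (0 < a \<or> 0 < b) \<longrightarrow> 0 < q) \<and>
                  (a \<le> 0 \<and> b \<le> 0 \<and> (a < 0 \<or> b < 0) \<longrightarrow> q < 0)"

abbreviation sdiv :: "real \<Rightarrow> real list \<Rightarrow> real list \<Rightarrow> bool" where
  "sdiv \<equiv> divrel (\<lambda>d u q. sadd (- d) u q) 0"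

text \<open>Here s is the last nonzero d. In the first claim the last nonzero q has the opposite sign; in
  the second one q has already made an extra sign change.\<close>
lemma sdiv_sign_changes_state:
  assumes "sdiv u ds qs"
  shows "(\<forall>s. 0 < s * u \<longrightarrow> Suc (sign_changes s ds) \<le> sign_changes (- s) qs) \<and>
         (\<forall>s. s \<noteq> 0 \<longrightarrow> 0 \<le> s * u \<longrightarrow> sign_changes s ds \<le> sign_changes s qs)"
  using assms
proof induction
  case (divrel_Nil u q)
  then show ?case
    by (auto simp: sadd_def zero_less_mult_iff mult_less_0_iff)
next
  case (divrel_Cons d u q ds qs)
  \<comment> \<open>The two induction hypotheses depend on the state only through its sign;
    \<open>a\<close> and \<open>b\<close> restate them for any state t of the right sign.\<close>
  have a: "Suc (sign_changes s ds) \<le> sign_changes t qs" if "0 < s * d" "s * t < 0" for s t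
    using divrel_Cons.IH sign_changes_sgn[of "-s" t qs] that
    by (auto simp: sgn_if zero_less_mult_iff mult_less_0_iff split: if_splits)
  have b: "sign_changes s ds \<le> sign_changes t qs" if "s \<noteq> 0" "0 \<le> s * d" "0 < s * t" for s t
    using divrel_Cons.IH sign_changes_sgn[of "s" t qs] that
    by (auto simp: sgn_if zero_less_mult_iff mult_less_0_iff split: if_splits)
  have c: "sign_changes d ds = sign_changes s ds" if "0 < s * d" for s
    using sign_changes_sgn[of d s ds] that by (auto simp: sgn_if zero_less_mult_iff)
  show ?case
  proof (intro conjI allI impI)
    fix s assume s: "0 < s * u"
    then have "s \<noteq> 0" "u \<noteq> 0" by auto
    then consider "d = 0" | "0 < s * d" | "s * d < 0"
      by (metis linorder_neqE_linordered_idom mult_eq_0_iff)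
    then show "Suc (sign_changes s (d # ds)) \<le> sign_changes (- s) (q # qs)"
    proof cases
      case 1
      \<comment> \<open>For d = 0 the sum is u alone, so q has the sign of s and is itself the extra
        sign change after - s.\<close>
      then have "0 < s * q" using divrel_Cons.hyps(1) s
        by (auto simp: sadd_def zero_less_mult_iff)
      then show ?thesis using b[of s q] 1 \<open>s \<noteq> 0\<close> by auto
    next
      case 2
      then have "d \<noteq> 0" "\<not> s * d < 0" by auto
      then have "sign_changes s (d # ds) = sign_changes s ds" using c[OF 2] by simp
      moreover have "Suc (sign_changes s ds) \<le> sign_changes (- s) qs" 
        using a[of s "-s"] 2 \<open>s \<noteq> 0\<close> not_real_square_gt_zero[of s] by fastforce
      moreover have "Suc (sign_changes s ds) \<le> sign_changes q qs" if "s * q < 0"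
        using a[of s q] 2 that by auto
      moreover have "sign_changes s ds \<le> sign_changes q qs" if "0 < s * q"
        using b[of s q] 2 that \<open>s \<noteq> 0\<close> by auto
      ultimately show ?thesis 
        using \<open>s \<noteq> 0\<close> by (cases "s * q" "0::real" rule: linorder_cases) auto
    next
      case 3
      then have "d * q < 0" "0 < s * q" using divrel_Cons.hyps(1) s
        by (auto simp: sadd_def zero_less_mult_iff mult_less_0_iff)
      moreover have "Suc (sign_changes d ds) \<le> sign_changes q qs"
        using a[of d q] 3 \<open>d * q < 0\<close> not_real_square_gt_zero[of d] by force
      ultimately show ?thesis using 3 by auto
    qed
  next
    fix s assume s: "s \<noteq> 0" "0 \<le> s * u"
    consider "0 \<le> s * d" | "s * d < 0" by linarith
    then show "sign_changes s (d # ds) \<le> sign_changes s (q # qs)"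
    proof cases
      case 1
      then have "sign_changes s (d # ds) = sign_changes s ds" 
        using c[of s] s by (cases "d = 0") (auto simp: order_le_less)
      moreover have "sign_changes s ds \<le> sign_changes s qs" 
        using b[of s s] 1 s not_real_square_gt_zero[of s] by fastforce
      moreover have "sign_changes s qs \<le> Suc (sign_changes q qs)"
        by (rule sign_changes_state)
      moreover have "sign_changes s ds \<le> sign_changes q qs" if "0 < s * q"
        using b[of s q] 1 s that by auto
      ultimately show ?thesis 
        using s by (cases "s * q" "0::real" rule: linorder_cases) auto
    next
      case 2
      then have "d * q < 0" "0 < s * q" using divrel_Cons.hyps(1) s
        by (auto simp: sadd_def zero_less_mult_iff mult_less_0_iff zero_le_mult_iff)
      moreover have "Suc (sign_changes d ds) \<le> sign_changes q qs"
        using a[of d q] 2 \<open>d * q < 0\<close> not_real_square_gt_zero[of d] by force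
      ultimately show ?thesis using 2 by auto
    qed
  qed
qed

text \<open>At the first nonzero d the entry q is forced to have the sign of - d, which is the
  situation of the first claim of \<open>sdiv_sign_changes_state\<close>. The entries of qs before
  it can only add sign changes. Both Descartes' bound and its tropical analogue are
  instances.\<close>

lemma sdiv_sign_changes:
  assumes "sdiv 0 ds qs" "\<exists>d\<in>set ds. d \<noteq> 0"
  shows "Suc (sign_changes 0 ds) \<le> sign_changes 0 qs"
  using assms
proof (induction ds arbitrary: qs)
  case (Cons d ds)
  from Cons.prems(1) obtain q qs' where q: "qs = q # qs'" "sadd (- d) 0 q" "sdiv d ds qs'"
    by (auto elim: divrel.cases)
  show ?case
  proof (cases "d = 0")
    case True
    then have "Suc (sign_changes 0 ds) \<le> sign_changes 0 qs'" using Cons q by auto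
    then show ?thesis using True q sign_changes_0_le[of qs' q] by auto
  next
    case False
    then have "d * q < 0" using q by (auto simp: sadd_def mult_less_0_iff)
    moreover have "Suc (sign_changes d ds) \<le> sign_changes (- d) qs'"
      using sdiv_sign_changes_state[OF q(3)] False not_real_square_gt_zero[of d] by blast
    moreover have "sign_changes (- d) qs' = sign_changes q qs'" if "d * q < 0"
      using sign_changes_sgn[of "-d" q qs'] that by (auto simp: mult_less_0_iff)
    ultimately show ?thesis using False q by auto
  qed
qed auto

section \<open>Multiplicities over the signed tropical hyperfield\<close>

lemma sign_changes_eq_0D: "sign_changes s xs = 0 \<Longrightarrow> s \<noteq> 0 \<Longrightarrow> \<forall>x\<in>set xs. 0 \<le> s * x"
proof (induction xs arbitrary: s)
  case (Cons x xs)
  show ?case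
  proof (cases "x = 0")
    case False
    with Cons.prems have sx: "0 < s * x" by (auto simp: not_less order_le_less split: if_splits)
    have "\<forall>y\<in>set xs. 0 \<le> x * y" using Cons False by auto
    then have "0 \<le> s * y" if "y \<in> set xs" for y
      using sx that by (auto simp: zero_less_mult_iff zero_le_mult_iff)
    then show ?thesis using sx by auto
  qed (use Cons in auto)
qed simp

lemma sign_changes_pos_iff:
  "0 < sign_changes 0 xs \<longleftrightarrow> (\<exists>x\<in>set xs. 0 < x) \<and> (\<exists>x\<in>set xs. x < 0)" (is "?l \<longleftrightarrow> ?r")
proof
  assume ?r
  show ?l
  proof (rule ccontr)
    assume "\<not> ?l"
    then have "sign_changes 0 xs = 0" by simp
    then have "(\<forall>x\<in>set xs. 0 \<le> x) \<or> (\<forall>x\<in>set xs. x \<le> 0)"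
    proof (induction xs)
      case (Cons x xs)
      show ?case
      proof (cases "x = 0")
        case False
        then have "\<forall>y\<in>set xs. 0 \<le> x * y" using Cons.prems by (intro sign_changes_eq_0D) auto
        then have "(\<forall>y\<in>set xs. 0 \<le> y) \<or> (\<forall>y\<in>set xs. y \<le> 0)"
          using False by (cases "0 < x") (auto simp: zero_le_mult_iff)
        then show ?thesis using False \<open>\<forall>y\<in>set xs. 0 \<le> x * y\<close>
          by (cases "0 < x") (auto simp: zero_le_mult_iff)
      qed (use Cons in auto)
    qed simp
    with \<open>?r\<close> show False by force
  qed
qed (use sign_changes_pos_ex[of 0 xs] in auto)

lemma sign_changes_pos_nz: "0 < sign_changes 0 xs \<Longrightarrow> \<exists>x\<in>set xs. x \<noteq> 0"
  unfolding sign_changes_pos_iff by (metis less_irrefl)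

section \<open>Coefficients relative to a line of slope - r\<close>

fun tval_ge :: "real \<Rightarrow> trh \<Rightarrow> bool" where
  "tval_ge m TInf = True"
| "tval_ge m (TFin s v) = (m \<le> v)"

fun lsign :: "real \<Rightarrow> trh \<Rightarrow> real" where
  "lsign m TInf = 0"
| "lsign m (TFin s v) = (if v = m then (case s of Pos \<Rightarrow> 1 | Neg \<Rightarrow> -1) else 0)"

text \<open>The coefficient of degree k in the next two functions is compared with the line through
  (0, m) of slope -r.\<close>
fun weights_ge :: "real \<Rightarrow> real \<Rightarrow> trh list \<Rightarrow> bool" where
  "weights_ge r m [] = True"
| "weights_ge r m (x # xs) = (tval_ge m x \<and> weights_ge r (m - r) xs)"

fun levels :: "real \<Rightarrow> real \<Rightarrow> trh list \<Rightarrow> real list" where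
  "levels r m [] = []"
| "levels r m (x # xs) = lsign m x # levels r (m - r) xs"

lemma weights_ge_iff: "weights_ge r m xs \<longleftrightarrow> (\<forall>i<length xs. tval_ge (m - real i * r) (xs ! i))"
proof (induction xs arbitrary: m)
  case (Cons x xs)
  then show ?case using Cons by (simp add: All_less_Suc2 algebra_simps)
qed simp

lemma levels_eq_map: "levels r m xs = map (\<lambda>i. lsign (m - real i * r) (xs ! i)) [0..<length xs]"
proof (induction xs arbitrary: m)
  case (Cons x xs)
  then show ?case using Cons
    by (simp add: map_upt_Suc algebra_simps del: upt_Suc)
qed simp

text \<open>A nonzero entry at m' is a point on the line at height m', and no point lies below the
  line at height m. Hence the line touching the points from below is unique.\<close>

lemma weights_le_level:
  "weights_ge r m xs \<Longrightarrow> x \<in> set (levels r m' xs) \<Longrightarrow> x \<noteq> 0 \<Longrightarrow> m \<le> m'"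
proof (induction xs arbitrary: m m')
  case (Cons y xs)
  show ?case using Cons.prems Cons.IH[of "m - r" "m' - r"]
    by (cases y) (auto split: if_splits)
qed simp

text \<open>The first alternative is the polynomial all of whose coefficients are
  \<open>TInf\<close>; otherwise the line can be raised until it touches a point.\<close>

lemma ex_level:
  "(\<forall>m. weights_ge r m xs) \<or> (\<exists>m. weights_ge r m xs \<and> (\<exists>x\<in>set (levels r m xs). x \<noteq> 0))"
proof (induction xs)
  case (Cons x xs)
  have mono: "weights_ge r m' xs" if "weights_ge r m xs" "m' \<le> m" for m m'
    using that(1)
  proof (simp only: weights_ge_iff, intro allI impI)
    fix i assume *: "\<forall>i<length xs. tval_ge (m - real i * r) (xs ! i)" "i < length xs"
    then show "tval_ge (m' - real i * r) (xs ! i)"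
      using that(2) *(1)[rule_format, of i] by (cases "xs ! i") auto
  qed
  have head: "\<exists>m. weights_ge r m (x # xs) \<and> (\<exists>x\<in>set (levels r m (x # xs)). x \<noteq> 0)"
    if "x = TFin s v" "weights_ge r (v - r) xs" for s v
    using that by (intro exI[of _ v]) (auto split: sgn.splits)
  show ?case using Cons
  proof
    assume "\<forall>m. weights_ge r m xs"
    then show ?thesis using head by (cases x) auto
  next
    assume "\<exists>m. weights_ge r m xs \<and> (\<exists>x\<in>set (levels r m xs). x \<noteq> 0)"
    then obtain m where m: "weights_ge r m xs" "\<exists>x\<in>set (levels r m xs). x \<noteq> 0" by auto
    show ?thesis
    proof (cases "tval_ge (m + r) x")
      case True
      then have "weights_ge r (m + r) (x # xs) \<and> (\<exists>y\<in>set (levels r (m + r) (x # xs)). y \<noteq> 0)"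
        using m by auto
      then show ?thesis by blast
    next
      case False
      then obtain s v where v: "x = TFin s v" "v - r \<le> m" by (cases x) auto
      then show ?thesis using head mono[OF m(1) v(2)] by auto
    qed
  qed
qed simp

lemma hadd_TInf [simp]: "hadd x TInf = {x}"
  by (cases x) auto

lemma sgn_neg_neg [simp]: "sgn_neg (sgn_neg s) = s"
  by (cases s) auto

lemma sgn_neg_neq [simp]: "s \<noteq> sgn_neg s" "sgn_neg s \<noteq> s"
  by (cases s; simp)+

lemma sgn_mul_Pos [simp]: "sgn_mul s Pos = s"
  by (cases s) auto

lemma sgn_exhaust_neq: "s \<noteq> s' \<longleftrightarrow> s' = sgn_neg s"
  by (cases s; cases s') auto

abbreviation tdiv :: "real \<Rightarrow> trh \<Rightarrow> trh list \<Rightarrow> trh list \<Rightarrow> bool" where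
  "tdiv r \<equiv> divrel (\<lambda>d u q. q \<in> hadd (tneg (tmul (TFin Pos r) d)) u) TInf"

text \<open>\<open>TInf\<close> stands for the absent coefficients before d_0 and after the last d,
  so the equations for the two extreme coefficients become hypersums with
  \<open>TInf\<close>.\<close>

lemma tdivides_iff_tdiv:
  "tdivides q (TFin Pos r) s \<longleftrightarrow> s \<noteq> [] \<and> tdiv r TInf s q"
proof (cases "s = []")
  case False
  then obtain n where n: "length s = Suc n" by (cases s) auto
  have "(\<forall>i\<le>Suc n. P i) \<longleftrightarrow> P 0 \<and> (\<forall>i. 1 \<le> i \<and> i \<le> n \<longrightarrow> P i) \<and> P (Suc n)" for P
    by (metis One_nat_def Suc_leI gr0I le_Suc_eq zero_le)
  then show ?thesis using False
    unfolding tdivides_def divrel_iff_nth n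
    by (auto simp: less_Suc_eq_le)
qed (auto simp: tdivides_def)

text \<open>Terms of weight m decide the sum unless they cancel, so discarding everything above the
  level sends hyperaddition to addition of signs. The level of d is m - r because multiplication by
  the root raises weights by r.\<close>

lemma hadd_level:
  assumes "tval_ge m u" "tval_ge (m - r) d" "q \<in> hadd (tneg (tmul (TFin Pos r) d)) u"
  shows "tval_ge m q \<and> sadd (- lsign (m - r) d) (lsign m u) (lsign m q)"
  using assms
  by (cases u; cases d; cases q)
     (auto simp: sadd_def split: if_splits sgn.splits)

lemma tdiv_levels:
  assumes "tdiv r u s q" "tval_ge m u" "weights_ge r (m - r) s"
  shows "weights_ge r m q \<and> sdiv (lsign m u) (levels r (m - r) s) (levels r m q)"
  using assms
proof (induction arbitrary: m)
  case (divrel_Nil u q)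
  then show ?case using hadd_level[of m u r TInf q] by (auto intro: divrel.intros)
next
  case (divrel_Cons d u q ds qs)
  then have "sadd (- lsign (m - r) d) (lsign m u) (lsign m q)" "tval_ge m q"
    using hadd_level[of m u r d q] by auto
  moreover have "weights_ge r (m - r) qs \<and>
     sdiv (lsign (m - r) d) (levels r (m - r - r) ds) (levels r (m - r) qs)"
    using divrel_Cons.IH[of "m - r"] divrel_Cons.prems by (simp only: weights_ge.simps simp_thms)
  ultimately show ?case by (simp only: levels.simps weights_ge.simps divrel.intros simp_thms)
qed

section \<open>Hypersums of several terms and tropical roots\<close>

text \<open>Terms of weight m cannot cancel if they share one sign, here carried by t; a single one
  of them then fixes weight and sign of every possible sum.\<close>

lemma hsum_same_sign:
  assumes "\<forall>x\<in>set xs. tval_ge m x \<and> 0 \<le> t * lsign m x" "t \<noteq> 0" "y \<in> hsum xs"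
  shows "tval_ge m y \<and> 0 \<le> t * lsign m y \<and> ((\<exists>x\<in>set xs. lsign m x \<noteq> 0) \<longrightarrow> 0 < t * lsign m y)"
  using assms
proof (induction xs arbitrary: y)
  case (Cons x xs)
  from Cons.prems obtain z where z: "z \<in> hsum xs" "y \<in> hadd x z" by auto
  have IH: "tval_ge m z" "0 \<le> t * lsign m z" "(\<exists>x\<in>set xs. lsign m x \<noteq> 0) \<longrightarrow> 0 < t * lsign m z"
    using Cons.IH[of z] Cons.prems z by auto
  have "tval_ge m x" "0 \<le> t * lsign m x" using Cons.prems by auto
  then have "tval_ge m y \<and> 0 \<le> t * lsign m y \<and> (lsign m x \<noteq> 0 \<or> 0 < t * lsign m z \<longrightarrow> 0 < t * lsign m y)"
    using IH(1,2) z(2) \<open>t \<noteq> 0\<close>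
    by (cases x; cases y; cases z) (auto split: if_splits sgn.splits)
  then show ?case using IH by auto
qed auto

lemma hsum_tval_ge: "\<forall>x\<in>set xs. tval_ge m x \<Longrightarrow> \<exists>z\<in>hsum xs. tval_ge m z"
proof (induction xs)
  case (Cons x xs)
  then obtain z where z: "z \<in> hsum xs" "tval_ge m z" by auto
  obtain y where "y \<in> hadd x z" "tval_ge m y"
  proof (cases "x \<in> hadd x z")
    case True
    then show ?thesis using that Cons.prems by simp
  next
    case False
    then have "z \<in> hadd x z" by (cases x; cases z) (auto split: if_splits)
    then show ?thesis using that z by simp
  qed
  then show ?case using z by auto
qed simp

lemma hsum_minimal:
  assumes "\<forall>x\<in>set xs. tval_ge m x" "x \<in> set xs" "lsign m x \<noteq> 0"
  shows "x \<in> hsum xs"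
  using assms
proof (induction xs)
  case (Cons y xs)
  show ?case
  proof (cases "x = y")
    case True
    obtain z where z: "z \<in> hsum xs" "tval_ge m z" using hsum_tval_ge[of xs m] Cons.prems by auto
    then have "y \<in> hadd y z" using Cons.prems True
      by (cases y; cases z) (auto split: if_splits)
    then show ?thesis using z True by auto
  next
    case False
    then have "x \<in> hsum xs" using Cons by auto
    moreover have "x \<in> hadd y x" using Cons.prems
      by (cases y; cases x) (auto split: if_splits)
    ultimately show ?thesis by auto
  qed
qed simp

lemma hsum_opposite:
  assumes "\<forall>x\<in>set xs. tval_ge m x" "TFin Pos m \<in> set xs" "TFin Neg m \<in> set xs" "tval_ge m z"
  shows "z \<in> hsum xs"
  using assms
proof (induction xs arbitrary: z)
  case (Cons y xs)
  consider "TFin Pos m \<in> set xs" "TFin Neg m \<in> set xs" | "y = TFin Pos m" "TFin Neg m \<in> set xs"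
    | "y = TFin Neg m" "TFin Pos m \<in> set xs"
    using Cons.prems by auto
  then show ?case
  proof cases
    case 1
    then have IH: "z \<in> hsum xs" if "tval_ge m z" for z using Cons that by auto
    have y: "tval_ge m y" using Cons.prems by simp
    \<comment> \<open>By induction every w of weight at least m is a sum of the remaining terms, so
      only a w with z in y + w is needed: z itself, unless z is heavier than y, and then - y, whose
      sum with y contains z.\<close>
    have "z \<in> hadd y z \<or> z \<in> hadd y (tneg y) \<or> (z \<in> hadd y TInf)"
      by (cases y; cases z) (auto simp: sgn_exhaust_neq)
    moreover have "tval_ge m (tneg y)" using y by (cases y) auto
    moreover have "z \<in> hsum (y # xs)" if "z \<in> hadd y w" "tval_ge m w" for w
      using IH[OF that(2)] that(1) by auto
    ultimately show ?thesis using \<open>tval_ge m z\<close> by (meson tval_ge.simps(1))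
  next
    case 2
    have "TFin Neg m \<in> hsum xs" using hsum_minimal[of xs m "TFin Neg m"] 2 Cons.prems by auto
    moreover have "z \<in> hadd y (TFin Neg m)" using 2 Cons.prems by (cases z) auto
    ultimately show ?thesis by auto
  next
    case 3
    have "TFin Pos m \<in> hsum xs" using hsum_minimal[of xs m "TFin Pos m"] 3 Cons.prems by auto
    moreover have "z \<in> hadd y (TFin Pos m)" using 3 Cons.prems by (cases z) auto
    ultimately show ?thesis by auto
  qed
qed simp

lemma tpow_TFin_Pos: "tpow (TFin Pos r) n = TFin Pos (real n * r)"
  by (induction n) (auto simp: tone_def algebra_simps)

text \<open>The level list of q consists of the signs of those terms c_i b^i that have the minimal
  weight m. By the two preceding facts \<open>TInf\<close> is among their sums exactly when both
  signs occur.\<close>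

lemma troot_iff:
  assumes "weights_ge r m q" "\<exists>x\<in>set (levels r m q). x \<noteq> 0"
  shows "troot q (TFin Pos r) \<longleftrightarrow> 0 < sign_changes 0 (levels r m q)"
proof -
  define xs where "xs = map (\<lambda>i. tmul (q ! i) (tpow (TFin Pos r) i)) [0..<length q]"
  have ge: "\<forall>x\<in>set xs. tval_ge m x"
  proof -
    have "tval_ge m (tmul (q ! i) (TFin Pos (real i * r)))" if "i < length q" for i
    proof -
      have "tval_ge (m - real i * r) (q ! i)" using assms(1) that by (auto simp: weights_ge_iff)
      then show ?thesis by (cases "q ! i") auto
    qed
    then show ?thesis by (auto simp: xs_def tpow_TFin_Pos)
  qed
  have lev: "levels r m q = map (lsign m) xs"
  proof -
    have "lsign m (tmul (q ! i) (TFin Pos (real i * r))) = lsign (m - real i * r) (q ! i)" for i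
      by (cases "q ! i") auto
    then show ?thesis by (simp add: xs_def levels_eq_map tpow_TFin_Pos)
  qed
  have lpos: "0 < lsign m x \<longleftrightarrow> x = TFin Pos m" and lneg: "lsign m x < 0 \<longleftrightarrow> x = TFin Neg m" for x
    by (cases x; auto split: sgn.splits)+
  show ?thesis
  proof
    assume "0 < sign_changes 0 (levels r m q)"
    then have "TFin Pos m \<in> set xs" "TFin Neg m \<in> set xs"
      by (auto simp: sign_changes_pos_iff lev lpos lneg)
    then show "troot q (TFin Pos r)"
      using hsum_opposite[OF ge, of TInf] by (simp add: troot_def xs_def)
  next
    assume "troot q (TFin Pos r)"
    then have T: "TInf \<in> hsum xs" by (simp add: troot_def xs_def)
    show "0 < sign_changes 0 (levels r m q)"
    proof (rule ccontr)
      assume "\<not> ?thesis"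
      then have "(\<forall>x\<in>set xs. 0 \<le> lsign m x) \<or> (\<forall>x\<in>set xs. lsign m x \<le> 0)"
        unfolding sign_changes_pos_iff lev by (auto simp: not_less)
      then obtain t :: real where "t \<noteq> 0" "\<forall>x\<in>set xs. 0 \<le> t * lsign m x"
        by (elim disjE) (force intro: that[of 1], force intro: that[of "-1"])
      with hsum_same_sign[of xs m t TInf] ge T assms(2) show False by (auto simp: lev)
    qed
  qed
qed

lemma tmult_ge_le_sign_changes:
  assumes "tmult_ge q b n" "b = TFin Pos r" "weights_ge r m q" "\<exists>x\<in>set (levels r m q). x \<noteq> 0"
  shows "n \<le> sign_changes 0 (levels r m q)"
  using assms
proof (induction arbitrary: m)
  case (one q b)
  then show ?case using troot_iff by auto
next
  case (step q b s n)
  have div: "tdiv r TInf s q" using step tdivides_iff_tdiv by auto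
  \<comment> \<open>The height at which s is touched is not known beforehand, so it is called m' -
    r. It exists because an s with all entries \<open>TInf\<close> would put q above the line at
    height m + 1.\<close>
  obtain m' where m': "weights_ge r (m' - r) s" "\<exists>x\<in>set (levels r (m' - r) s). x \<noteq> 0"
  proof -
    have "\<not> (\<forall>m'. weights_ge r m' s)"
    proof
      assume "\<forall>m'. weights_ge r m' s"
      then have "weights_ge r (m + 1) q" using tdiv_levels[OF div, of "m + 1"] by simp
      then have "m + 1 \<le> m" using weights_le_level step.prems(3) by blast
      then show False by simp
    qed
    then obtain m0 where "weights_ge r m0 s" "\<exists>x\<in>set (levels r m0 s). x \<noteq> 0"
      using ex_level[of r s] by auto
    then show ?thesis using that[of "m0 + r"] by simp
  qed
  have *: "weights_ge r m' q" "sdiv 0 (levels r (m' - r) s) (levels r m' q)"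
    using tdiv_levels[OF div, of m'] m' by auto
  then have sc: "Suc (sign_changes 0 (levels r (m' - r) s)) \<le> sign_changes 0 (levels r m' q)"
    using m' by (intro sdiv_sign_changes)
  then have "\<exists>x\<in>set (levels r m' q). x \<noteq> 0"
    using sign_changes_pos_nz by simp
  \<comment> \<open>A sign change of q at m' needs a nonzero entry there, so q is touched at both
    heights, and the touching line is unique.\<close>
  then have "m' = m"
    using weights_le_level[OF *(1)] weights_le_level[OF step.prems(2)] step.prems(3)
    by (meson order_antisym)
  then show ?case using step.IH[of "m' - r"] step.prems m' sc by auto
qed simp

section \<open>Quotients that lose exactly one sign change\<close>

text \<open>Solves for the coefficient u below a known d. The choice u = q works unless q is heavier
  than the product of d with the root; then u equal to that product cancels it and leaves room for
  q.\<close>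

lemma hadd_suffix:
  assumes "tval_ge m q" "tval_ge (m - r) d"
  shows "\<exists>u. q \<in> hadd (tneg (tmul (TFin Pos r) d)) u \<and> tval_ge m u \<and>
           (lsign m u = lsign m q \<or> lsign m u = lsign (m - r) d) \<and> (lsign m q \<noteq> 0 \<longrightarrow> u = q)"
proof (cases "q \<in> hadd (tneg (tmul (TFin Pos r) d)) q")
  case False
  then show ?thesis using assms
    by (cases q; cases d) (auto simp: sgn_exhaust_neq intro!: exI[of _ "tmul (TFin Pos r) d"] split: if_splits)
qed (use assms in auto)

text \<open>Solves for the next coefficient d when u is known. Either the product of d with the root
  is - q, or it is u, so that the cancellation leaves room for q. In both cases the sign of d at the
  level is opposite to q when q has weight m and is inherited from u otherwise.\<close>

lemma hadd_prefix:
  assumes "tval_ge m q" "tval_ge m u"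
  shows "\<exists>d. q \<in> hadd (tneg (tmul (TFin Pos r) d)) u \<and> tval_ge (m - r) d \<and>
           lsign (m - r) d = (if lsign m q \<noteq> 0 then - lsign m q else lsign m u)"
proof (cases "q \<in> hadd q u \<and> q \<noteq> TInf")
  case True
  then obtain s v where q: "q = TFin s v" by (cases q) auto
  have "lsign (m - r) (TFin (sgn_neg s) (v - r)) = (if lsign m q \<noteq> 0 then - lsign m q else lsign m u)"
    using True assms q by (cases u; cases s) (auto split: if_splits sgn.splits)
  then show ?thesis using True assms q by (intro exI[of _ "TFin (sgn_neg s) (v - r)"]) auto
next
  case False
  show ?thesis
  proof (cases u)
    case (TFin s v)
    have "lsign (m - r) (TFin s (v - r)) = (if lsign m q \<noteq> 0 then - lsign m q else lsign m u)"
      using False assms TFin by (cases q) (auto split: if_splits)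
    moreover have "q \<in> hadd (TFin (sgn_neg s) v) u"
      using False TFin by (cases q) (auto simp: sgn_exhaust_neq split: if_splits)
    ultimately show ?thesis using False assms TFin by (intro exI[of _ "TFin s (v - r)"]) auto
  qed (use False assms in \<open>cases q; auto intro!: exI[of _ TInf]\<close>)
qed

text \<open>Where all minimal terms have one sign, sums taken from the top keep that sign, so the
  quotient has no sign change. Here u is a result; its equality with a head of minimal weight is
  what permits gluing to a quotient computed from below.\<close>

lemma suffix_quotient:
  assumes "qs \<noteq> []" "weights_ge r m qs" "\<forall>x\<in>set (levels r m qs). 0 \<le> t * x"
  shows "\<exists>u s. tdiv r u s qs \<and> tval_ge m u \<and> weights_ge r (m - r) s \<and> 0 \<le> t * lsign m u \<and>
           (\<forall>x\<in>set (levels r (m - r) s). 0 \<le> t * x) \<and> (lsign m (hd qs) \<noteq> 0 \<longrightarrow> u = hd qs)"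
  using assms
proof (induction qs arbitrary: m)
  case (Cons q qs)
  show ?case
  proof (cases "qs = []")
    case True
    then show ?thesis using Cons.prems
      by (intro exI[of _ q] exI[of _ "[]"]) (auto intro: divrel.intros)
  next
    case False
    from Cons.IH[of "m - r"] False Cons.prems obtain d s where
      IH: "tdiv r d s qs" "tval_ge (m - r) d" "weights_ge r (m - r - r) s" "0 \<le> t * lsign (m - r) d"
        "\<forall>x\<in>set (levels r (m - r - r) s). 0 \<le> t * x"
      by auto
    obtain u where u: "q \<in> hadd (tneg (tmul (TFin Pos r) d)) u" "tval_ge m u"
        "lsign m u = lsign m q \<or> lsign m u = lsign (m - r) d" "lsign m q \<noteq> 0 \<longrightarrow> u = q"
      using hadd_suffix[of m q r d] IH Cons.prems by auto
    then have "tdiv r u (d # s) (q # qs)" using IH by (intro divrel.intros) auto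
    moreover have "0 \<le> t * lsign m u" using IH(4) Cons.prems u(3) by auto
    moreover note u
    ultimately show ?thesis using IH
      by (intro exI[of _ u] exI[of _ "d # s"]) auto
  qed
qed simp

text \<open>Partial sums from below are used up to the last sign change, partial sums from above
  after it; the choice made at that position makes both fit.\<close>
lemma prefix_quotient:
  assumes "weights_ge r m qs" "tval_ge m u" "0 < sign_changes (- lsign m u) (levels r m qs)"
  shows "\<exists>s. tdiv r u s qs \<and> weights_ge r (m - r) s \<and>
     Suc (sign_changes (lsign m u) (levels r (m - r) s)) = sign_changes (- lsign m u) (levels r m qs)"
  using assms
proof (induction qs arbitrary: m u)
  case (Cons q qs)
  let ?l = "lsign m q" and ?s = "lsign m u"
  show ?case
  proof (cases "?l \<noteq> 0 \<and> sign_changes ?l (levels r (m - r) qs) = 0")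
    case True
    then have "0 < ?s * ?l" and one: "sign_changes (- ?s) (levels r m (q # qs)) = 1"
      using Cons.prems by (auto split: if_splits)
    \<comment> \<open>Here q makes the last sign change, counted from state - u. Hence u and q both
      have weight m and the same sign and are equal, so the value that
      \<open>suffix_quotient\<close> returns is the prescribed u.\<close>
    then have eq: "u = q" "?s = ?l" "?s \<noteq> 0" by (cases u; cases q; auto split: if_splits sgn.splits)+
    have "\<forall>x\<in>set (levels r (m - r) qs). 0 \<le> ?l * x"
      using True by (intro sign_changes_eq_0D) auto
    then obtain u' s where s: "tdiv r u' s (q # qs)" "weights_ge r (m - r) s"
      "\<forall>x\<in>set (levels r (m - r) s). 0 \<le> ?l * x" "u' = q"
      using suffix_quotient[of "q # qs" r m ?l] True Cons.prems by auto
    then have "sign_changes ?s (levels r (m - r) s) = 0"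
      using eq by (intro sign_changes_same) auto
    then show ?thesis using s eq one by auto
  next
    case False
    obtain d where R: "q \<in> hadd (tneg (tmul (TFin Pos r) d)) u" and d1: "tval_ge (m - r) d"
      and d2: "lsign (m - r) d = (if ?l \<noteq> 0 then - ?l else ?s)"
      using hadd_prefix[of m q u r] Cons.prems by auto
    \<comment> \<open>The sign of d is always opposite to that of the last nonzero q, so the changes
      in the quotient and in q occur at the same positions until the gluing point.\<close>
    have sc: "sign_changes (- ?s) (levels r m (q # qs)) =
         (if ?s * lsign (m - r) d < 0 then 1 else 0) + sign_changes (- lsign (m - r) d) (levels r (m - r) qs)"
      using d2 zero_le_square[of ?s] by (cases "?l = 0") (simp_all add: not_less[symmetric])
    have "0 < sign_changes (- lsign (m - r) d) (levels r (m - r) qs)"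
    proof (cases "?l = 0")
      case True
      then have "lsign (m - r) d = ?s" using d2 by simp
      then show ?thesis using Cons.prems(3) unfolding sc by (simp add: mult_less_0_iff)
    next
      case l: False
      then show ?thesis using False d2 by simp
    qed
    from Cons.IH[OF _ d1 this] Cons.prems obtain s where
      s: "tdiv r d s qs" "weights_ge r (m - r - r) s"
      "Suc (sign_changes (lsign (m - r) d) (levels r (m - r - r) s)) =
        sign_changes (- lsign (m - r) d) (levels r (m - r) qs)"
      by auto
    have "tdiv r u (d # s) (q # qs)" using R s by (intro divrel.intros)
    moreover have d3: "sign_changes ?s (levels r (m - r) (d # s)) =
       (if ?s * lsign (m - r) d < 0 then 1 else 0) + sign_changes (lsign (m - r) d) (levels r (m - r - r) s)"
      using d2 by auto
    have "Suc (sign_changes ?s (levels r (m - r) (d # s))) = sign_changes (- ?s) (levels r m (q # qs))"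
      unfolding d3 sc s(3)[symmetric] by (rule add_Suc_right[symmetric])
    moreover have "weights_ge r (m - r) (d # s)" using d1 s(2) by simp
    ultimately show ?thesis by blast
  qed
qed simp

lemma tmult_ge_sign_changes:
  assumes "weights_ge r m q"
  shows "tmult_ge q (TFin Pos r) (sign_changes 0 (levels r m q))"
  using assms
proof (induction "sign_changes 0 (levels r m q)" arbitrary: q m)
  case 0
  then show ?case by (metis tmult_ge.zero)
next
  case (Suc n)
  then obtain s where s: "tdiv r TInf s q" "weights_ge r (m - r) s"
    "Suc (sign_changes 0 (levels r (m - r) s)) = sign_changes 0 (levels r m q)"
    using prefix_quotient[of r m q TInf] by auto
  have "s \<noteq> []" using s Suc.hyps(2) by (auto elim!: divrel.cases)
  then have "tdivides q (TFin Pos r) s" using s tdivides_iff_tdiv by auto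
  moreover have "\<exists>x\<in>set (levels r m q). x \<noteq> 0"
    using sign_changes_pos_nz Suc.hyps(2) by simp
  then have "troot q (TFin Pos r)" using troot_iff[OF Suc.prems] Suc.hyps(2) by auto
  moreover have "tmult_ge s (TFin Pos r) n"
    using Suc.hyps(1)[of "m - r" s] Suc.hyps(2) s by (metis Suc_inject)
  ultimately show ?case using Suc.hyps(2) tmult_ge.step by metis
qed

text \<open>The upper bound is also what makes the set under \<open>Max\<close> in
  \<open>tmult\<close> finite; \<open>prefix_quotient\<close>, applied repeatedly, attains
  it.\<close>

theorem tmult_eq_sign_changes:
  assumes "weights_ge r m q" "\<exists>x\<in>set (levels r m q). x \<noteq> 0"
  shows "tmult q (TFin Pos r) = sign_changes 0 (levels r m q)"
  unfolding tmult_def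
proof (rule Max_eqI)
  show "finite {n. tmult_ge q (TFin Pos r) n}"
    by (rule finite_subset[of _ "{..sign_changes 0 (levels r m q)}"])
       (use tmult_ge_le_sign_changes[OF _ refl assms] in auto)
qed (use assms tmult_ge_le_sign_changes[OF _ refl assms] tmult_ge_sign_changes in auto)

section \<open>Real polynomials attaining Descartes' bound\<close>

lemma real_square_pos: "x \<noteq> 0 \<Longrightarrow> 0 < x * (x::real)"
  by (metis not_real_square_gt_zero)

text \<open>For r > 0 the sign of u - r d is a possible sum of the signs of - d and u, so dividing
  by x - r is an instance of \<open>sdiv\<close> and costs at least one sign change. The list length
  n is only a bound on the degree; it drops by one with each division, and the entry of s just past
  its list is 0.\<close>

lemma descartes_bound:
  fixes f :: "real poly"
  assumes "f \<noteq> 0" "degree f < n"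
  shows "card {x. 0 < x \<and> poly f x = 0} \<le> sign_changes 0 (map (coeff f) [0..<n])"
  using assms
proof (induction n arbitrary: f)
  case (Suc n)
  show ?case
  proof (cases "{x. 0 < x \<and> poly f x = 0} = {}")
    case False
    then obtain r where r: "0 < r" "poly f r = 0" by auto
    then obtain s where s: "f = [:- r, 1:] * s" by (metis poly_eq_0_iff_dvd dvd_def)
    have "s \<noteq> 0" using s Suc.prems by auto
    have deg: "degree f = Suc (degree s)"
      using \<open>s \<noteq> 0\<close> unfolding s by (subst degree_mult_eq) auto
    then have sn: "degree s < n" using Suc.prems by simp
    have cf: "coeff f i = (if i = 0 then 0 else coeff s (i - 1)) - r * coeff s i" for i
      unfolding s by (cases i) auto
    have "sdiv 0 (map (coeff s) [0..<n]) (map (coeff f) [0..<Suc n])"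
    proof -
      have *: "sadd (- (if i < n then coeff s i else 0)) (if i = 0 then 0 else coeff s (i - 1)) (coeff f i)" 
        if "i \<le> n" for i
      proof -
        have "(if i < n then coeff s i else 0) = coeff s i"
          using sn by (simp add: coeff_eq_0)
        moreover have "sadd (- d) u (u - r * d)" for u d
        proof (cases d "0::real" rule: linorder_cases)
          case less
          then have "r * d < 0" using r(1) by (simp add: mult_pos_neg)
          then show ?thesis using less by (auto simp: sadd_def)
        next
          case greater
          then have "0 < r * d" using r(1) by simp
          then show ?thesis using greater by (auto simp: sadd_def)
        qed (auto simp: sadd_def)
        ultimately show ?thesis unfolding cf by simp
      qed
      show ?thesis unfolding divrel_iff_nth
      proof (intro conjI allI impI)
        fix i assume "i \<le> length (map (coeff s) [0..<n])"
        then show "sadd (- (if i < length (map (coeff s) [0..<n]) then map (coeff s) [0..<n] ! i else 0))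
            (if i = 0 then 0 else map (coeff s) [0..<n] ! (i - 1)) (map (coeff f) [0..<Suc n] ! i)"
          using *[of i] by (cases "i < n"; cases "i = 0") (simp_all del: upt_Suc)
      qed simp
    qed
    moreover have "\<exists>d\<in>set (map (coeff s) [0..<n]). d \<noteq> 0"
      using sn \<open>s \<noteq> 0\<close> by (auto intro!: bexI[of _ "degree s"])
    ultimately have "Suc (sign_changes 0 (map (coeff s) [0..<n])) \<le> sign_changes 0 (map (coeff f) [0..<Suc n])"
      by (rule sdiv_sign_changes)
    moreover have "{x. 0 < x \<and> poly f x = 0} \<subseteq> insert r {x. 0 < x \<and> poly s x = 0}"
      by (auto simp: s)
    then have "card {x. 0 < x \<and> poly f x = 0} \<le> card (insert r {x. 0 < x \<and> poly s x = 0})"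
      using poly_roots_finite[OF \<open>s \<noteq> 0\<close>] by (intro card_mono) auto
    moreover have "card (insert r {x. 0 < x \<and> poly s x = 0}) \<le> Suc (card {x. 0 < x \<and> poly s x = 0})"
      by (rule card_insert_le_m1) auto
    moreover note Suc.IH[OF \<open>s \<noteq> 0\<close> sn]
    ultimately show ?thesis by linarith
  next
    case True
    then show ?thesis by (simp only: card.empty zero_le)
  qed
qed simp

section \<open>Sign alternations under a small dominant term\<close>

text \<open>A certificate for positive roots that survives small perturbations. The points decrease,
  so the head is the largest one; its sign s decides whether a new leading term creates a further
  alternation.\<close>

definition alternates :: "real poly \<Rightarrow> real \<Rightarrow> real list \<Rightarrow> bool" where
  "alternates f s xs \<longleftrightarrow> xs \<noteq> [] \<and> (\<forall>x\<in>set xs. 0 < x \<and> poly f x \<noteq> 0) \<and>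
     successively (\<lambda>x y. y < x \<and> poly f x * poly f y < 0) xs \<and> 0 < poly f (hd xs) * s"

lemma alternates_card_roots:
  assumes "alternates f s xs"
  shows "length xs \<le> Suc (card {x. 0 < x \<and> poly f x = 0})"
proof -
  \<comment> \<open>Keeping the roots below the head of the list makes the next root, found above
    that head, a new one.\<close>
  have *: "\<exists>S. finite S \<and> card S = length xs - 1 \<and> S \<subseteq> {y. 0 < y \<and> y < hd xs \<and> poly f y = 0}"
    if "\<forall>x\<in>set xs. 0 < x" "successively (\<lambda>x y. y < x \<and> poly f x * poly f y < 0) xs" for xs
    using that
  proof (induction xs rule: induct_list012)
    case (3 x y xs)
    then obtain S where S: "finite S" "card S = length (y # xs) - 1" 
      "S \<subseteq> {z. 0 < z \<and> z < y \<and> poly f z = 0}" by auto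
    obtain z where z: "y < z" "z < x" "poly f z = 0"
      using poly_IVT[of y x f] 3 by (auto simp: mult.commute)
    then have "z \<notin> S" using S by auto
    then have "finite (insert z S) \<and> card (insert z S) = length (x # y # xs) - 1 \<and> 
        insert z S \<subseteq> {w. 0 < w \<and> w < hd (x # y # xs) \<and> poly f w = 0}"
      using S z 3 by auto
    then show ?case by blast
  qed (auto intro!: exI[of _ "{}"])
  have "f \<noteq> 0" using assms by (auto simp: alternates_def)
  obtain S where S: "finite S" "card S = length xs - 1" "S \<subseteq> {y. 0 < y \<and> y < hd xs \<and> poly f y = 0}"
    using *[of xs] assms by (auto simp: alternates_def)
  then have "card S \<le> card {x. 0 < x \<and> poly f x = 0}"
    using poly_roots_finite[OF \<open>f \<noteq> 0\<close>] by (intro card_mono) auto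
  then show ?thesis using S by linarith
qed

text \<open>For small e the signs at the finitely many given points do not change, while far to the
  right the new term dominates and gives the sign of t.\<close>

lemma alternates_add_monom:
  assumes "alternates f s xs" "degree f < m" "t \<noteq> 0" "s \<noteq> 0"
  shows "\<forall>\<^sub>F e in at_right 0. \<exists>ys. alternates (f + monom (t * e) m) t ys \<and>
           length ys = length xs + (if s * t < 0 then 1 else 0)"
proof -
  have "\<forall>\<^sub>F e in at_right 0. sgn (poly (f + monom (t * e) m) x) = sgn (poly f x)" if "x \<in> set xs" for x
  proof -
    have nz: "poly f x \<noteq> 0" using assms(1) that by (auto simp: alternates_def)
    have "((\<lambda>e. poly f x + t * e * x ^ m) \<longlongrightarrow> poly f x + t * 0 * x ^ m) (at_right 0)"
      by (intro tendsto_intros)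
    then have lim: "((\<lambda>e. poly (f + monom (t * e) m) x) \<longlongrightarrow> poly f x) (at_right 0)"
      by (simp add: poly_monom)
    show ?thesis
    proof (cases "poly f x > 0")
      case True
      then show ?thesis using order_tendstoD(1)[OF lim True] by (elim eventually_mono) auto
    next
      case False
      then have "poly f x < 0" using nz by simp
      then show ?thesis using order_tendstoD(2)[OF lim, of 0] by (auto elim!: eventually_mono)
    qed
  qed
  then have "\<forall>\<^sub>F e in at_right 0. \<forall>x\<in>set xs. sgn (poly (f + monom (t * e) m) x) = sgn (poly f x)"
    by (intro eventually_ball_finite) auto
  moreover have "\<forall>\<^sub>F e in at_right (0::real). 0 < e" by (rule eventually_at_right_less)
  ultimately show ?thesis
  proof eventually_elim
    case (elim e)
    define g where "g = f + monom (t * e) m"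
    have sg: "sgn (poly g x) = sgn (poly f x)" if "x \<in> set xs" for x using elim that by (simp add: g_def)
    have prod: "poly g x * poly g y < 0 \<longleftrightarrow> poly f x * poly f y < 0" if "x \<in> set xs" "y \<in> set xs" for x y
      using sg[OF that(1)] sg[OF that(2)] by (metis sgn_less sgn_mult)
    have hd: "hd xs \<in> set xs" using assms(1) by (auto simp: alternates_def)
    have xs: "(\<forall>x\<in>set xs. 0 < x \<and> poly g x \<noteq> 0)"
        "successively (\<lambda>x y. y < x \<and> poly g x * poly g y < 0) xs"
    proof -
      show "\<forall>x\<in>set xs. 0 < x \<and> poly g x \<noteq> 0"
        using assms(1) sg unfolding alternates_def by (metis sgn_0_0)
      have "successively (\<lambda>x y. y < x \<and> poly f x * poly f y < 0) xs"
        using assms(1) by (simp add: alternates_def)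
      then show "successively (\<lambda>x y. y < x \<and> poly g x * poly g y < 0) xs"
        by (rule successively_mono) (use prod in blast)+
    qed
    have hs: "0 < poly g (hd xs) * s"
    proof -
      have "0 < poly f (hd xs) * s" using assms(1) by (simp add: alternates_def)
      moreover have "sgn (poly g (hd xs) * s) = sgn (poly f (hd xs) * s)"
        by (simp only: sgn_mult sg[OF hd])
      ultimately show ?thesis by (simp only: sgn_1_pos[symmetric])
    qed
    show ?case
    proof (cases "s * t < 0")
      case False
      then have "0 < s * t" using assms by (simp add: order_less_le not_less)
      then have "0 < poly g (hd xs) * t" using hs by (auto simp: zero_less_mult_iff)
      then have "alternates g t xs"
        using xs assms(1) unfolding alternates_def by blast
      then show ?thesis using False unfolding g_def by (intro exI[of _ xs]) simp
    next
      case True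
      have "lead_coeff g = t * e" 
        using assms(2,3) elim(2) unfolding g_def
        by (subst lead_coeff_add_le) (auto simp: degree_monom_eq lead_coeff_monom)
      \<comment> \<open>The factor t makes the leading coefficient t^2 e, which is positive for
        either sign of t.\<close>
      then have "0 < lead_coeff (smult t g)" using elim(2) real_square_pos[OF assms(3)] assms(3)
        by (simp add: lead_coeff_smult mult.assoc[symmetric])
      then obtain N where N: "\<forall>x\<ge>N. lead_coeff (smult t g) \<le> poly (smult t g) x"
        using poly_pinfty_gt_lc by blast
      define y where "y = max N (hd xs + 1)"
      have y: "0 < t * poly g y" "hd xs < y"
        using N[rule_format, of y] \<open>0 < lead_coeff (smult t g)\<close> by (auto simp: y_def)
      have "0 < y" using hd xs(1) y(2) by (meson order_less_trans)
      have "poly g y * poly g (hd xs) < 0" using y True hs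
        unfolding mult_less_0_iff zero_less_mult_iff by argo
      then have "successively (\<lambda>x y. y < x \<and> poly g x * poly g y < 0) (y # xs)"
        using xs(2) y(2) by (simp only: successively_Cons simp_thms)
      moreover have "poly g y \<noteq> 0" using y(1) by auto
      then have "\<forall>x\<in>set (y # xs). 0 < x \<and> poly g x \<noteq> 0"
        using xs(1) \<open>0 < y\<close> by (simp only: list.set ball_simps simp_thms)
      moreover have "0 < poly g (hd (y # xs)) * t" using y(1) by (simp add: mult.commute)
      ultimately have "alternates g t (y # xs)" unfolding alternates_def by blast
      then show ?thesis using True unfolding g_def by (intro exI[of _ "y # xs"]) simp
    qed
  qed
qed

text \<open>The root 0 is exempt because an initial form may contain a power of x; that factor comes
  from roots of larger valuation.\<close>

definition simple_nz_roots :: "complex poly \<Rightarrow> bool" where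
  "simple_nz_roots f \<longleftrightarrow> (\<forall>z. z \<noteq> 0 \<longrightarrow> poly f z = 0 \<longrightarrow> poly (pderiv f) z \<noteq> 0)"

text \<open>A nonzero multiple root z of f + c x^m satisfies z f'(z) = m f(z). This polynomial
  \<open>h\<close> does not depend on c and is nonzero, its coefficient at deg f being (deg f - m)
  times that of f. So there are finitely many candidates z, and each determines c = - f(z) / z^m;
  only finitely many e are bad.\<close>

lemma simple_nz_roots_add_monom:
  fixes f :: "complex poly"
  assumes "f \<noteq> 0" "degree f < m" "t \<noteq> 0"
  shows "\<forall>\<^sub>F e in at_right 0. simple_nz_roots (f + monom (of_real (t * e)) m)"
proof -
  define h where "h = pCons 0 (pderiv f) - smult (of_nat m) f"
  have "coeff h (degree f) = (of_nat (degree f) - of_nat m) * lead_coeff f"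
    by (cases "degree f") (auto simp: h_def coeff_pderiv algebra_simps)
  moreover have "(of_nat (degree f) - of_nat m :: complex) \<noteq> 0"
    using assms(2) by (metis nat_neq_iff of_nat_eq_iff right_minus_eq)
  ultimately have "h \<noteq> 0" using assms(1) by auto
  define B where "B = (\<lambda>z. Re (- poly f z / z ^ m) / t) ` {z. poly h z = 0}"
  have "finite B" unfolding B_def using poly_roots_finite[OF \<open>h \<noteq> 0\<close>] by simp
  then have "\<forall>\<^sub>F e in at_right 0. \<forall>b\<in>B. e \<noteq> b"
    by (intro eventually_ball_finite) (auto intro: eventually_neq_at_within)
  then show ?thesis
  proof eventually_elim
    case (elim e)
    show ?case unfolding simple_nz_roots_def
    proof (intro allI impI notI)
      fix z assume z: "z \<noteq> 0" "poly (f + monom (of_real (t * e)) m) z = 0"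
        "poly (pderiv (f + monom (of_real (t * e)) m)) z = 0"
      have 1: "poly f z = - of_real (t * e) * z ^ m" using z(2)
        by (simp add: poly_monom eq_neg_iff_add_eq_0)
      have "m \<noteq> 0" using assms by auto
      then have "z ^ m = z * z ^ (m - 1)" by (metis power_eq_if)
      moreover have "poly (pderiv f) z = - of_nat m * of_real (t * e) * z ^ (m - 1)"
        using z(3) by (simp add: pderiv_add pderiv_monom poly_monom eq_neg_iff_add_eq_0)
      ultimately have "poly h z = 0" by (simp add: h_def 1)
      moreover have "Re (- poly f z / z ^ m) / t = e"
        using z(1) assms(3) unfolding 1 by simp
      ultimately have "e \<in> B" unfolding B_def by force
      with elim show False by auto
    qed
  qed
qed

section \<open>Coefficients generic for every index set\<close>

definition subsum :: "(nat \<Rightarrow> real) \<Rightarrow> nat set \<Rightarrow> real poly" where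
  "subsum c A = (\<Sum>k\<in>A. monom (c k) k)"

definition restr :: "(nat \<Rightarrow> real) \<Rightarrow> nat set \<Rightarrow> nat \<Rightarrow> real list" where
  "restr c A n = map (\<lambda>k. if k \<in> A then c k else 0) [0..<n]"

lemma coeff_subsum: "finite A \<Longrightarrow> coeff (subsum c A) k = (if k \<in> A then c k else 0)"
  by (simp add: subsum_def coeff_sum)

lemma degree_subsum_less: "A \<subseteq> {..<n} \<Longrightarrow> A \<noteq> {} \<Longrightarrow> degree (subsum c A) < n"
proof -
  assume A: "A \<subseteq> {..<n}" "A \<noteq> {}"
  then have "finite A" "0 < n" by (auto intro: finite_subset)
  then have "degree (subsum c A) \<le> n - 1"
    using A by (intro degree_le) (auto simp: coeff_subsum)
  then show ?thesis using \<open>0 < n\<close> by simp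
qed

lemma subsum_insert:
  assumes "A \<subseteq> {..<n}"
  shows "subsum (c(n := x)) (insert n A) = subsum c A + monom x n"
proof -
  have "finite A" "n \<notin> A" using assms by (auto intro: finite_subset)
  moreover have "subsum (c(n := x)) A = subsum c A"
    unfolding subsum_def using \<open>n \<notin> A\<close> by (intro sum.cong) auto
  ultimately show ?thesis by (simp add: subsum_def add.commute)
qed

lemma restr_Suc:
  assumes "A \<subseteq> {..<n}"
  shows "restr (c(n := x)) (insert n A) (Suc n) = restr c A n @ [x]"
    "restr (c(n := x)) A (Suc n) = restr c A n @ [0]"
  using assms by (auto simp: restr_def)

text \<open>Sharpness is expressed by alternations, one more than the roots they certify, because
  these persist when a small term is added. The sign at the largest point is tied to the last
  nonzero coefficient, which decides the next sign change.\<close>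

definition descartes_sharp :: "(nat \<Rightarrow> real) \<Rightarrow> nat set \<Rightarrow> nat \<Rightarrow> bool" where
  "descartes_sharp c A n \<longleftrightarrow> (\<exists>xs. alternates (subsum c A) (last_nz 0 (restr c A n)) xs \<and>
     length xs = Suc (sign_changes 0 (restr c A n)))"

lemma last_nz_snoc: "last_nz s (xs @ [x]) = (if x = 0 then last_nz s xs else x)"
  by (simp add: last_nz_def)

lemma descartes_sharp_Suc: "A \<subseteq> {..<n} \<Longrightarrow> descartes_sharp c A n \<Longrightarrow> descartes_sharp (c(n := x)) A (Suc n)"
proof -
  assume A: "A \<subseteq> {..<n}" "descartes_sharp c A n"
  have "subsum (c(n := x)) A = subsum c A"
    unfolding subsum_def using A by (intro sum.cong) auto
  then show ?thesis using A by (simp add: descartes_sharp_def restr_Suc last_nz_snoc sign_changes_snoc)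
qed

lemma descartes_sharp_insert:
  assumes "A \<subseteq> {..<n}" "A \<noteq> {} \<longrightarrow> descartes_sharp c A n" "t \<noteq> 0"
  shows "\<forall>\<^sub>F e in at_right 0. descartes_sharp (c(n := t * e)) (insert n A) (Suc n)"
proof (cases "A = {}")
  case True
  have z: "last_nz 0 (restr c {} n) = 0" "sign_changes 0 (restr c {} n) = 0"
    by (induction n) (auto simp: restr_def last_nz_def sign_changes_snoc)
  have "\<forall>\<^sub>F e in at_right (0::real). 0 < e" by (rule eventually_at_right_less)
  then show ?thesis
  proof eventually_elim
    case (elim e)
    have "alternates (monom (t * e) n) (t * e) [1]"
      using elim assms(3) real_square_pos[of "t * e"]
      by (simp add: alternates_def poly_monom)
    then show ?case
      unfolding descartes_sharp_def subsum_insert[OF assms(1)] restr_Suc[OF assms(1)]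
      using True z elim assms(3)
      by (intro exI[of _ "[1]"]) (auto simp: subsum_def last_nz_snoc sign_changes_snoc)
  qed
next
  case False
  define s where "s = last_nz 0 (restr c A n)"
  obtain xs where xs: "alternates (subsum c A) s xs" "length xs = Suc (sign_changes 0 (restr c A n))"
    using assms(2) False by (auto simp: descartes_sharp_def s_def)
  have "s \<noteq> 0" using xs by (auto simp: alternates_def)
  have "\<forall>\<^sub>F e in at_right 0. \<exists>ys. alternates (subsum c A + monom (t * e) n) t ys \<and>
           length ys = length xs + (if s * t < 0 then 1 else 0)"
    using alternates_add_monom[OF xs(1) _ assms(3) \<open>s \<noteq> 0\<close>] degree_subsum_less assms(1) False by auto
  moreover have "\<forall>\<^sub>F e in at_right (0::real). 0 < e" by (rule eventually_at_right_less)
  ultimately show ?thesis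
  proof eventually_elim
    case (elim e)
    then obtain ys where ys: "alternates (subsum c A + monom (t * e) n) t ys" 
      "length ys = length xs + (if s * t < 0 then 1 else 0)" by auto
    have "alternates (subsum c A + monom (t * e) n) (t * e) ys"
      using ys(1) elim(2) by (auto simp: alternates_def mult.assoc[symmetric])
    moreover have "s * (t * e) < 0 \<longleftrightarrow> s * t < 0" 
      using elim(2) by (simp add: mult.assoc[symmetric] mult_less_0_iff)
    ultimately show ?case
      unfolding descartes_sharp_def subsum_insert[OF assms(1)] restr_Suc[OF assms(1)]
      using ys(2) xs(2) elim(2) assms(3) 
      by (intro exI[of _ ys]) (auto simp: last_nz_snoc sign_changes_snoc s_def[symmetric])
  qed
qed

abbreviation cpoly :: "real poly \<Rightarrow> complex poly" where
  "cpoly \<equiv> map_poly complex_of_real"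

text \<open>The new coefficient is t n * e. Each subset of the old indices requires e to be small or
  to avoid finitely many values, so all subsets can be served by one e > 0; index sets without n
  keep their certificates.\<close>

lemma ex_generic:
  assumes "\<And>k. t k \<noteq> 0"
  shows "\<exists>c. (\<forall>k. 0 < c k * t k) \<and> (\<forall>A\<subseteq>{..<n}. A \<noteq> {} \<longrightarrow>
      simple_nz_roots (cpoly (subsum c A)) \<and> descartes_sharp c A n \<and>
      descartes_sharp (\<lambda>k. (-1) ^ k * c k) A n)"
proof (induction n)
  case 0
  show ?case using assms by (intro exI[of _ t]) (auto simp: less_le)
next
  case (Suc n)
  then obtain c where c: "\<And>k. 0 < c k * t k" 
    and IH: "\<And>A. A \<subseteq> {..<n} \<Longrightarrow> A \<noteq> {} \<Longrightarrow> simple_nz_roots (cpoly (subsum c A)) \<and> descartes_sharp c A n \<and>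
      descartes_sharp (\<lambda>k. (-1) ^ k * c k) A n" by blast
  let ?alt = "\<lambda>c k. (-1) ^ k * c k :: real"
  \<comment> \<open>Passing to - x multiplies the new coefficient by (-1)^n, so
    \<open>descartes_sharp_insert\<close> also covers negative roots, with (-1)^n * t n in place of
    t n.\<close>
  have alt: "?alt (c(n := x)) = (?alt c)(n := (-1) ^ n * x)" for x by auto
  have cp: "cpoly (f + monom x n) = cpoly f + monom (of_real x) n" for f x
    by (intro poly_eqI) (auto simp: coeff_map_poly)
  have ev: "\<forall>\<^sub>F e in at_right 0. simple_nz_roots (cpoly (subsum (c(n := t n * e)) (insert n A))) \<and>
      descartes_sharp (c(n := t n * e)) (insert n A) (Suc n) \<and>
      descartes_sharp (?alt (c(n := t n * e))) (insert n A) (Suc n)" if A: "A \<subseteq> {..<n}" for A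
  proof (intro eventually_conj)
    show "\<forall>\<^sub>F e in at_right 0. descartes_sharp (c(n := t n * e)) (insert n A) (Suc n)"
      using descartes_sharp_insert[OF A] IH[OF A] assms by auto
    have "\<forall>\<^sub>F e in at_right 0. descartes_sharp ((?alt c)(n := ((-1) ^ n * t n) * e)) (insert n A) (Suc n)"
      using IH[OF A] assms by (intro descartes_sharp_insert[OF A]) auto
    then show "\<forall>\<^sub>F e in at_right 0. descartes_sharp (?alt (c(n := t n * e))) (insert n A) (Suc n)"
      unfolding alt by (simp add: mult.assoc)
    show "\<forall>\<^sub>F e in at_right 0. simple_nz_roots (cpoly (subsum (c(n := t n * e)) (insert n A)))"
    proof (cases "A = {}")
      case True
      have "\<forall>\<^sub>F e in at_right (0::real). 0 < e" by (rule eventually_at_right_less)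
      then show ?thesis
      proof eventually_elim
        case (elim e)
        then show ?case unfolding subsum_insert[OF A] cp using True assms[of n]
          by (auto simp: subsum_def simple_nz_roots_def poly_monom)
      qed
    next
      case False
      have fin: "finite A" using A finite_subset by blast
      obtain k where "k \<in> A" using False by blast
      then have "coeff (subsum c A) k \<noteq> 0" using c[of k] fin by (auto simp: coeff_subsum)
      then have "subsum c A \<noteq> 0" by auto
      then show ?thesis unfolding subsum_insert[OF A] cp
        using degree_subsum_less[OF A False]
        by (intro simple_nz_roots_add_monom) (auto simp: map_poly_eq_0_iff degree_map_poly assms)
    qed
  qed
  have "\<forall>\<^sub>F e in at_right 0. \<forall>A\<in>Pow {..<n}. simple_nz_roots (cpoly (subsum (c(n := t n * e)) (insert n A))) \<and>
      descartes_sharp (c(n := t n * e)) (insert n A) (Suc n) \<and>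
      descartes_sharp (?alt (c(n := t n * e))) (insert n A) (Suc n)"
    using ev by (intro eventually_ball_finite) auto
  moreover have "\<forall>\<^sub>F e in at_right (0::real). 0 < e" by (rule eventually_at_right_less)
  ultimately have "\<forall>\<^sub>F e in at_right 0. 0 < e \<and> (\<forall>A\<in>Pow {..<n}. simple_nz_roots (cpoly (subsum (c(n := t n * e)) (insert n A))) \<and>
      descartes_sharp (c(n := t n * e)) (insert n A) (Suc n) \<and>
      descartes_sharp (?alt (c(n := t n * e))) (insert n A) (Suc n))"
    by eventually_elim auto
  from eventually_happens'[OF _ this] obtain e where e: "0 < e"
    "\<And>A. A \<subseteq> {..<n} \<Longrightarrow> simple_nz_roots (cpoly (subsum (c(n := t n * e)) (insert n A))) \<and>
      descartes_sharp (c(n := t n * e)) (insert n A) (Suc n) \<and>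
      descartes_sharp (?alt (c(n := t n * e))) (insert n A) (Suc n)" by auto
  let ?c = "c(n := t n * e)"
  show ?case
  proof (intro exI[of _ ?c] conjI allI impI)
    have "0 < e * (t n * t n)" using e(1) real_square_pos[OF assms[of n]] by (rule mult_pos_pos)
    then show "0 < ?c k * t k" for k using c[of k] by (simp add: mult_ac)
    fix A assume A: "A \<subseteq> {..<Suc n}" "A \<noteq> {}"
    have "simple_nz_roots (cpoly (subsum ?c A)) \<and> descartes_sharp ?c A (Suc n) \<and> descartes_sharp (?alt ?c) A (Suc n)"
    proof (cases "n \<in> A")
      case True
      then have "A = insert n (A - {n})" "A - {n} \<subseteq> {..<n}" using A by (auto simp: less_Suc_eq)
      then show ?thesis using e(2)[of "A - {n}"] by metis
    next
      case False
      then have A': "A \<subseteq> {..<n}" using A by (metis lessThan_Suc subset_insert)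
      have "subsum ?c A = subsum c A" unfolding subsum_def using False by (intro sum.cong) auto
      then show ?thesis using IH[OF A' A(2)] descartes_sharp_Suc[OF A'] unfolding alt by auto
    qed
    then show "simple_nz_roots (cpoly (subsum ?c A))" "descartes_sharp ?c A (Suc n)" "descartes_sharp (?alt ?c) A (Suc n)"
      by auto
  qed
qed

lemma descartes_sharp_card:
  assumes "A \<subseteq> {..<n}" "A \<noteq> {}" "descartes_sharp c A n"
  shows "card {x. 0 < x \<and> poly (subsum c A) x = 0} = sign_changes 0 (restr c A n)"
proof (rule antisym)
  have "finite A" using assms finite_subset by blast
  obtain xs where xs: "alternates (subsum c A) (last_nz 0 (restr c A n)) xs"
     "length xs = Suc (sign_changes 0 (restr c A n))" using assms(3) by (auto simp: descartes_sharp_def)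
  then show "sign_changes 0 (restr c A n) \<le> card {x. 0 < x \<and> poly (subsum c A) x = 0}"
    using alternates_card_roots[OF xs(1)] by simp
  have "subsum c A \<noteq> 0" using xs(1) by (auto simp: alternates_def)
  moreover have "restr c A n = map (coeff (subsum c A)) [0..<n]"
    using \<open>finite A\<close> by (simp add: restr_def coeff_subsum)
  ultimately show "card {x. 0 < x \<and> poly (subsum c A) x = 0} \<le> sign_changes 0 (restr c A n)"
    using descartes_bound degree_subsum_less assms by metis
qed

theorem ex_sharp_coefficients:
  assumes "\<And>k. t k \<noteq> 0"
  shows "\<exists>c. (\<forall>k. 0 < c k * t k) \<and> (\<forall>A\<subseteq>{..<n}. A \<noteq> {} \<longrightarrow>
      simple_nz_roots (cpoly (subsum c A)) \<and>
      card {x. 0 < x \<and> poly (subsum c A) x = 0} = sign_changes 0 (restr c A n) \<and>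
      card {x. x < 0 \<and> poly (subsum c A) x = 0} = sign_changes 0 (restr (\<lambda>k. (-1) ^ k * c k) A n))"
proof -
  obtain c where c: "\<And>k. 0 < c k * t k" and sharp: "\<And>A. A \<subseteq> {..<n} \<Longrightarrow> A \<noteq> {} \<Longrightarrow>
      simple_nz_roots (cpoly (subsum c A)) \<and> descartes_sharp c A n \<and>
      descartes_sharp (\<lambda>k. (-1) ^ k * c k) A n"
    using ex_generic[of t n] assms by blast
  have "card {x. x < 0 \<and> poly (subsum c A) x = 0} = card {x. 0 < x \<and> poly (subsum (\<lambda>k. (-1) ^ k * c k) A) x = 0}"
    for A
  proof (rule bij_betw_same_card)
    have "poly (subsum (\<lambda>k. (-1) ^ k * c k) A) x = poly (subsum c A) (- x)" for x
      by (simp add: subsum_def poly_sum poly_monom power_minus[of x] mult_ac)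
    then show "bij_betw uminus {x. x < 0 \<and> poly (subsum c A) x = 0}
        {x. 0 < x \<and> poly (subsum (\<lambda>k. (-1) ^ k * c k) A) x = 0}"
      by (intro bij_betwI[where g = uminus]) auto
  qed
  then show ?thesis
    using c sharp descartes_sharp_card by (intro exI[of _ c]) auto
qed

section \<open>Series with left-finite support\<close>

text \<open>The support condition of Levi-Civita series, here with real exponents. It is stronger
  than being well-ordered and passes to limits in which the coefficients below each bound become
  stationary.\<close>

definition left_finite :: "(real \<Rightarrow> 'a::zero) \<Rightarrow> bool" where
  "left_finite f \<longleftrightarrow> (\<forall>b. finite {x. x \<le> b \<and> f x \<noteq> 0})"

lemma left_finite_lower_bound:
  assumes "left_finite f"
  shows "\<exists>m. \<forall>x. f x \<noteq> 0 \<longrightarrow> m \<le> x"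
proof -
  define S where "S = {x. x \<le> 0 \<and> f x \<noteq> 0}"
  have "finite S" using assms by (auto simp: left_finite_def S_def)
  then have "Min (insert 0 S) \<le> x" if "f x \<noteq> 0" for x
    using that by (cases "x \<le> 0") (auto simp: S_def intro: order_trans[OF Min_le])
  then show ?thesis by blast
qed

lemma left_finite_least:
  assumes "left_finite f" "f x \<noteq> 0"
  obtains m where "f m \<noteq> 0" "\<And>y. f y \<noteq> 0 \<Longrightarrow> m \<le> y"
proof -
  define S where "S = {y. y \<le> x \<and> f y \<noteq> 0}"
  have S: "finite S" "x \<in> S" using assms by (auto simp: left_finite_def S_def)
  then have M: "Min S \<in> S" by (intro Min_in) auto
  moreover have "Min S \<le> y" if "f y \<noteq> 0" for y
    using that M S(1) by (cases "y \<le> x") (auto simp: S_def)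
  ultimately show ?thesis using that[of "Min S"] by (auto simp: S_def)
qed

lemma left_finite_hahn:
  assumes "left_finite f"
  shows "hahn f"
  unfolding hahn_def
proof (intro allI impI)
  fix S assume S: "S \<subseteq> {x. f x \<noteq> 0}" "S \<noteq> {}"
  then obtain x where x: "x \<in> S" by auto
  have "finite {y \<in> S. y \<le> x}"
    using assms S by (auto simp: left_finite_def intro: finite_subset[of _ "{y. y \<le> x \<and> f y \<noteq> 0}"])
  moreover have "{y \<in> S. y \<le> x} \<noteq> {}" using x by auto
  ultimately have M: "Min {y \<in> S. y \<le> x} \<in> {y \<in> S. y \<le> x}" "\<forall>y\<in>{y \<in> S. y \<le> x}. Min {y \<in> S. y \<le> x} \<le> y"
    using Min_in[of "{y \<in> S. y \<le> x}"] by simp_all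
  then have "Min {y \<in> S. y \<le> x} \<le> y" if "y \<in> S" for y
    using that by (cases "y \<le> x") auto
  with M(1) show "\<exists>m\<in>S. \<forall>y\<in>S. m \<le> y" by blast
qed

text \<open>The product \<open>hmul\<close> indexed by the first exponent alone, so that a sum can
  be extended to any finite set of exponents containing the relevant ones.\<close>

definition conv :: "(real \<Rightarrow> complex) \<Rightarrow> (real \<Rightarrow> complex) \<Rightarrow> real \<Rightarrow> complex" where
  "conv f g x = (\<Sum>a | f a \<noteq> 0 \<and> g (x - a) \<noteq> 0. f a * g (x - a))"

lemma conv_eq_sum:
  assumes "finite A" "\<And>a. f a \<noteq> 0 \<Longrightarrow> g (x - a) \<noteq> 0 \<Longrightarrow> a \<in> A"
  shows "conv f g x = (\<Sum>a\<in>A. f a * g (x - a))"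
  unfolding conv_def using assms by (intro sum.mono_neutral_left) auto

lemma conv_commute: "conv f g = conv g f"
proof
  fix x
  show "conv f g x = conv g f x"
    unfolding conv_def
    by (rule sum.reindex_bij_witness[of _ "\<lambda>a. x - a" "\<lambda>a. x - a"]) auto
qed

lemma conv_nonzeroE:
  assumes "conv f g x \<noteq> 0"
  obtains a where "f a \<noteq> 0" "g (x - a) \<noteq> 0"
proof -
  have "{a. f a \<noteq> 0 \<and> g (x - a) \<noteq> 0} \<noteq> {}" using assms unfolding conv_def by (metis sum.empty)
  then show ?thesis using that by auto
qed

lemma left_finite_conv:
  assumes "left_finite f" "left_finite g"
  shows "left_finite (conv f g)"
  unfolding left_finite_def
proof
  fix b
  obtain m n where mn: "\<And>x. f x \<noteq> 0 \<Longrightarrow> m \<le> x" "\<And>x. g x \<noteq> 0 \<Longrightarrow> n \<le> x"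
    using assms[THEN left_finite_lower_bound] by metis
  have "{x. x \<le> b \<and> conv f g x \<noteq> 0} \<subseteq>
      (\<lambda>(a, c). a + c) ` ({a. a \<le> b - n \<and> f a \<noteq> 0} \<times> {c. c \<le> b - m \<and> g c \<noteq> 0})"
  proof
    fix x assume x: "x \<in> {x. x \<le> b \<and> conv f g x \<noteq> 0}"
    then obtain a where a: "f a \<noteq> 0" "g (x - a) \<noteq> 0" by (auto elim: conv_nonzeroE)
    then have "(a, x - a) \<in> {a. a \<le> b - n \<and> f a \<noteq> 0} \<times> {c. c \<le> b - m \<and> g c \<noteq> 0}"
      using mn(1)[OF a(1)] mn(2)[OF a(2)] x by auto
    then show "x \<in> (\<lambda>(a, c). a + c) ` ({a. a \<le> b - n \<and> f a \<noteq> 0} \<times> {c. c \<le> b - m \<and> g c \<noteq> 0})"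
      by (rule rev_image_eqI) simp
  qed
  moreover have "finite ({a. a \<le> b - n \<and> f a \<noteq> 0} \<times> {c. c \<le> b - m \<and> g c \<noteq> 0})"
    using assms by (auto simp: left_finite_def)
  ultimately show "finite {x. x \<le> b \<and> conv f g x \<noteq> 0}" using finite_subset by blast
qed

lemma conv_assoc:
  assumes "left_finite f" "left_finite g" "left_finite h"
  shows "conv (conv f g) h = conv f (conv g h)"
proof
  fix x
  obtain m n l where mnl: "\<And>x. f x \<noteq> 0 \<Longrightarrow> m \<le> x" "\<And>x. g x \<noteq> 0 \<Longrightarrow> n \<le> x" "\<And>x. h x \<noteq> 0 \<Longrightarrow> l \<le> x"
    using assms[THEN left_finite_lower_bound] by metis
  \<comment> \<open>Exponents with a + b + c = x and b \<ge> n, c \<ge> l force a \<le> x - n - l,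
    and similarly for c. These fixed finite windows turn associativity into an exchange of two
    finite sums.\<close>
  define A where "A = {a. a \<le> x - n - l \<and> f a \<noteq> 0}"
  define C where "C = {c. c \<le> x - n - m \<and> h c \<noteq> 0}"
  have fin: "finite A" "finite C" using assms by (auto simp: left_finite_def A_def C_def)
  have "conv (conv f g) h x = conv h (conv f g) x" by (simp add: conv_commute)
  also have "\<dots> = (\<Sum>c\<in>C. h c * conv f g (x - c))"
  proof (rule conv_eq_sum[OF fin(2)])
    fix c assume c: "h c \<noteq> 0" "conv f g (x - c) \<noteq> 0"
    then obtain a where "f a \<noteq> 0" "g (x - c - a) \<noteq> 0" by (auto elim: conv_nonzeroE)
    then show "c \<in> C" using c mnl(1)[of a] mnl(2)[of "x - c - a"] by (auto simp: C_def)
  qed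
  also have "\<dots> = (\<Sum>c\<in>C. h c * (\<Sum>a\<in>A. f a * g (x - c - a)))"
  proof (intro sum.cong refl arg_cong2[where f = "(*)"] conv_eq_sum[OF fin(1)])
    fix c a assume "c \<in> C" "f a \<noteq> 0" "g (x - c - a) \<noteq> 0"
    then show "a \<in> A" using mnl(3)[of c] mnl(2)[of "x - c - a"] by (auto simp: A_def C_def)
  qed
  also have "\<dots> = (\<Sum>c\<in>C. \<Sum>a\<in>A. h c * (f a * g (x - c - a)))" by (simp add: sum_distrib_left)
  also have "\<dots> = (\<Sum>a\<in>A. \<Sum>c\<in>C. h c * (f a * g (x - c - a)))" by (rule sum.swap)
  also have "\<dots> = (\<Sum>a\<in>A. \<Sum>c\<in>C. f a * (h c * g (x - a - c)))"
    by (simp add: mult.left_commute algebra_simps)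
  also have "\<dots> = (\<Sum>a\<in>A. f a * (\<Sum>c\<in>C. h c * g (x - a - c)))" by (simp add: sum_distrib_left)
  also have "\<dots> = (\<Sum>a\<in>A. f a * conv h g (x - a))"
  proof (intro sum.cong refl arg_cong2[where f = "(*)"] conv_eq_sum[OF fin(2), symmetric])
    fix c a assume "a \<in> A" "h c \<noteq> 0" "g (x - a - c) \<noteq> 0"
    then show "c \<in> C" using mnl(1)[of a] mnl(2)[of "x - a - c"] by (auto simp: A_def C_def)
  qed
  also have "\<dots> = conv f (conv h g) x"
  proof (rule conv_eq_sum[OF fin(1), symmetric])
    fix a assume a: "f a \<noteq> 0" "conv h g (x - a) \<noteq> 0"
    then obtain c where "h c \<noteq> 0" "g (x - a - c) \<noteq> 0" by (auto elim: conv_nonzeroE)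
    then show "a \<in> A" using a mnl(3)[of c] mnl(2)[of "x - a - c"] by (auto simp: A_def)
  qed
  finally show "conv (conv f g) h x = conv f (conv g h) x" by (simp add: conv_commute)
qed

section \<open>The integral domain of left-finite series, as a type so that \<open>poly\<close>
  applies\<close>

typedef lc = "{f :: real \<Rightarrow> complex. left_finite f}"
  morphisms lc_nth Abs_lc
  by (rule exI[of _ "\<lambda>_. 0"]) (simp add: left_finite_def)

setup_lifting type_definition_lc

lemma left_finite_lc_nth [simp]: "left_finite (lc_nth f)"
  using lc_nth by simp

lemma lc_eqI: "(\<And>x. lc_nth f x = lc_nth g x) \<Longrightarrow> f = g"
  by (metis ext lc_nth_inject)

lemma left_finite_add: "left_finite f \<Longrightarrow> left_finite g \<Longrightarrow> left_finite (\<lambda>x. f x + g x :: complex)"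
  unfolding left_finite_def
proof
  fix b assume "\<forall>b. finite {x. x \<le> b \<and> f x \<noteq> 0}" "\<forall>b. finite {x. x \<le> b \<and> g x \<noteq> 0}"
  then have "finite ({x. x \<le> b \<and> f x \<noteq> 0} \<union> {x. x \<le> b \<and> g x \<noteq> 0})" by simp
  then show "finite {x. x \<le> b \<and> f x + g x \<noteq> 0}" by (rule rev_finite_subset) auto
qed

lift_definition monom_lc :: "complex \<Rightarrow> real \<Rightarrow> lc" is "\<lambda>c v x. if x = v then c else 0"
  by (auto simp: left_finite_def intro: finite_subset[of _ "{v}" for v])

instantiation lc :: comm_ring_1
begin

lift_definition zero_lc :: lc is "\<lambda>_. 0" by (simp add: left_finite_def)
definition one_lc :: lc where "one_lc = monom_lc 1 0"
lift_definition uminus_lc :: "lc \<Rightarrow> lc" is "\<lambda>f x. - f x" by (simp add: left_finite_def)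
lift_definition plus_lc :: "lc \<Rightarrow> lc \<Rightarrow> lc" is "\<lambda>f g x. f x + g x" by (rule left_finite_add)
definition minus_lc :: "lc \<Rightarrow> lc \<Rightarrow> lc" where "minus_lc f g = f + - g"
lift_definition times_lc :: "lc \<Rightarrow> lc \<Rightarrow> lc" is conv by (rule left_finite_conv)

instance
proof
  fix a b c :: lc
  show "a * b * c = a * (b * c)" by transfer (rule conv_assoc)
  show "a * b = b * a" by transfer (rule conv_commute)
  show "1 * a = a" unfolding one_lc_def
  proof (transfer, rule ext)
    fix a :: "real \<Rightarrow> complex" and x
    have "conv (\<lambda>x. if x = 0 then 1 else 0) a x = (\<Sum>z\<in>{0}. (if z = 0 then 1 else 0) * a (x - z))"
      by (rule conv_eq_sum) (auto split: if_splits)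
    then show "conv (\<lambda>x. if x = 0 then 1 else 0) a x = a x" by simp
  qed
  show "(a + b) * c = a * c + b * c"
  proof (transfer, rule ext)
    fix a b c :: "real \<Rightarrow> complex" and x
    assume lf: "left_finite a" "left_finite b" "left_finite c"
    obtain n where n: "\<And>x. c x \<noteq> 0 \<Longrightarrow> n \<le> x" using left_finite_lower_bound[OF lf(3)] by metis
    define A where "A = {z. z \<le> x - n \<and> a z \<noteq> 0} \<union> {z. z \<le> x - n \<and> b z \<noteq> 0}"
    have fin: "finite A" using lf by (auto simp: left_finite_def A_def)
    have A: "z \<in> A" if "a z \<noteq> 0 \<or> b z \<noteq> 0" "c (x - z) \<noteq> 0" for z
      using that n[of "x - z"] by (auto simp: A_def)
    have "conv (\<lambda>x. a x + b x) c x = (\<Sum>z\<in>A. (a z + b z) * c (x - z))"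
      using A by (intro conv_eq_sum fin) force
    moreover have "conv a c x = (\<Sum>z\<in>A. a z * c (x - z))" using A by (intro conv_eq_sum fin) force
    moreover have "conv b c x = (\<Sum>z\<in>A. b z * c (x - z))" using A by (intro conv_eq_sum fin) force
    ultimately show "conv (\<lambda>x. a x + b x) c x = conv a c x + conv b c x"
      by (simp add: algebra_simps sum.distrib)
  qed
  show "a + b + c = a + (b + c)" by transfer (simp add: add.assoc)
  show "a + b = b + a" by transfer (simp add: add.commute)
  show "0 + a = a" by transfer simp
  show "- a + a = 0" by transfer simp
  show "a - b = a + - b" by (simp add: minus_lc_def)
  have "lc_nth 0 0 \<noteq> lc_nth 1 0" by (simp add: one_lc_def monom_lc.rep_eq zero_lc.rep_eq)
  then show "(0::lc) \<noteq> 1" by metis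
qed

end

lemma lc_nth_simps [simp]: "lc_nth 0 x = 0" "lc_nth (f + g) x = lc_nth f x + lc_nth g x"
  "lc_nth (- f) x = - lc_nth f x" "lc_nth (f - g) x = lc_nth f x - lc_nth g x"
  "lc_nth (monom_lc c v) x = (if x = v then c else 0)"
  "lc_nth 1 x = (if x = 0 then 1 else 0)"
  unfolding minus_lc_def one_lc_def zero_lc.rep_eq plus_lc.rep_eq uminus_lc.rep_eq monom_lc.rep_eq
  by simp_all

lemma monom_lc_eq_0 [simp]: "monom_lc c v = 0 \<longleftrightarrow> c = 0"
proof
  assume "monom_lc c v = 0"
  then have "lc_nth (monom_lc c v) v = 0" by simp
  then show "c = 0" by simp
qed (auto intro: lc_eqI)

lemma lc_nth_sum: "lc_nth (sum f A) x = (\<Sum>a\<in>A. lc_nth (f a) x)"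
  by (induction A rule: infinite_finite_induct) auto

lemma lc_nth_times: "lc_nth (f * g) = conv (lc_nth f) (lc_nth g)"
  by (rule times_lc.rep_eq)

text \<open>A lower bound for the valuation rather than the valuation, so that 0 needs no special
  value.\<close>

definition lc_ge :: "real \<Rightarrow> lc \<Rightarrow> bool" where
  "lc_ge m f \<longleftrightarrow> (\<forall>x<m. lc_nth f x = 0)"

lemma lc_ge_iff: "lc_ge m f \<longleftrightarrow> (\<forall>x. lc_nth f x \<noteq> 0 \<longrightarrow> m \<le> x)"
  by (auto simp: lc_ge_def not_less[symmetric])

lemma lc_ge_0 [simp]: "lc_ge m 0"
  by (simp add: lc_ge_def)

lemma lc_ge_add [intro]: "lc_ge m f \<Longrightarrow> lc_ge m g \<Longrightarrow> lc_ge m (f + g)"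
  and lc_ge_diff [intro]: "lc_ge m f \<Longrightarrow> lc_ge m g \<Longrightarrow> lc_ge m (f - g)"
  and lc_ge_uminus [intro]: "lc_ge m f \<Longrightarrow> lc_ge m (- f)"
  by (auto simp: lc_ge_def)

lemma lc_ge_sum [intro]: "(\<And>a. a \<in> A \<Longrightarrow> lc_ge m (f a)) \<Longrightarrow> lc_ge m (sum f A)"
  by (auto simp: lc_ge_def lc_nth_sum)

lemma lc_ge_mono: "lc_ge m f \<Longrightarrow> m' \<le> m \<Longrightarrow> lc_ge m' f"
  by (auto simp: lc_ge_def)

lemma lc_ge_monom [simp]: "lc_ge m (monom_lc c v) \<longleftrightarrow> c = 0 \<or> m \<le> v"
  by (auto simp: lc_ge_iff)

lemma lc_ge_mult: "lc_ge m f \<Longrightarrow> lc_ge n g \<Longrightarrow> lc_ge (m + n) (f * g)"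
  unfolding lc_ge_iff lc_nth_times
proof (intro allI impI)
  fix x assume *: "\<forall>x. lc_nth f x \<noteq> 0 \<longrightarrow> m \<le> x" "\<forall>x. lc_nth g x \<noteq> 0 \<longrightarrow> n \<le> x"
    "conv (lc_nth f) (lc_nth g) x \<noteq> 0"
  then obtain a where "lc_nth f a \<noteq> 0" "lc_nth g (x - a) \<noteq> 0" by (auto elim: conv_nonzeroE)
  then show "m + n \<le> x" using *(1)[rule_format, of a] *(2)[rule_format, of "x - a"] by linarith
qed

text \<open>The bounds need not be attained: if one is not, both sides vanish.\<close>

lemma lc_nth_mult_low:
  assumes "lc_ge m f" "lc_ge n g"
  shows "lc_nth (f * g) (m + n) = lc_nth f m * lc_nth g n"
proof -
  have "conv (lc_nth f) (lc_nth g) (m + n) = (\<Sum>a\<in>{m}. lc_nth f a * lc_nth g (m + n - a))"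
  proof (rule conv_eq_sum)
    fix a assume a: "lc_nth f a \<noteq> 0" "lc_nth g (m + n - a) \<noteq> 0"
    have "m \<le> a" "n \<le> m + n - a" using assms a by (auto simp: lc_ge_iff)
    then show "a \<in> {m}" by simp
  qed simp
  then show ?thesis by (simp add: lc_nth_times)
qed

lemma monom_lc_mult: "monom_lc c v * monom_lc d w = monom_lc (c * d) (v + w)"
proof (rule lc_eqI)
  fix x
  have "conv (lc_nth (monom_lc c v)) (lc_nth (monom_lc d w)) x =
      (\<Sum>a\<in>{v}. lc_nth (monom_lc c v) a * lc_nth (monom_lc d w) (x - a))"
    by (rule conv_eq_sum) (auto split: if_splits)
  then show "lc_nth (monom_lc c v * monom_lc d w) x = lc_nth (monom_lc (c * d) (v + w)) x"
    by (auto simp: lc_nth_times)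
qed

lemma monom_lc_power: "monom_lc c v ^ n = monom_lc (c ^ n) (real n * v)"
  by (induction n) (auto simp: one_lc_def monom_lc_mult algebra_simps)

lemma lc_leading:
  assumes "f \<noteq> 0"
  obtains m where "lc_ge m f" "lc_nth f m \<noteq> 0"
proof -
  obtain x where "lc_nth f x \<noteq> 0" using assms lc_eqI[of f 0] by auto
  from left_finite_least[OF left_finite_lc_nth this] show ?thesis
    using that by (metis lc_ge_iff)
qed

instance lc :: idom
proof
  fix a b :: lc assume "a \<noteq> 0" "b \<noteq> 0"
  then obtain m n where "lc_ge m a" "lc_nth a m \<noteq> 0" "lc_ge n b" "lc_nth b n \<noteq> 0"
    by (metis lc_leading)
  then have "lc_nth (a * b) (m + n) \<noteq> 0" by (simp add: lc_nth_mult_low)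
  then show "a * b \<noteq> 0" by auto
qed

lemma hmul_lc_nth: "hmul (lc_nth f) (lc_nth g) = lc_nth (f * g)"
proof
  fix x
  show "hmul (lc_nth f) (lc_nth g) x = lc_nth (f * g) x"
    unfolding hmul_def lc_nth_times conv_def
    by (rule sum.reindex_bij_witness[of _ "\<lambda>a. (a, x - a)" fst]) auto
qed

lemma hval_lc_nth:
  assumes "lc_ge m f" "lc_nth f m \<noteq> 0"
  shows "hval (lc_nth f) = m"
  unfolding hval_def using assms by (intro Least_equality) (auto simp: lc_ge_iff)

lemma lead_root_iff:
  "lead_root (lc_nth f) v L \<longleftrightarrow> lc_ge v f \<and> lc_nth f v \<noteq> 0 \<and> L (lc_nth f v)"
proof (cases "f = 0")
  case True
  then show ?thesis by (auto simp: lead_root_def fun_eq_iff)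
next
  case False
  then obtain m where m: "lc_ge m f" "lc_nth f m \<noteq> 0" by (rule lc_leading)
  have "lc_nth f \<noteq> (\<lambda>_. 0)" using m by metis
  moreover have "v = m" if "lc_ge v f" "lc_nth f v \<noteq> 0"
    using that m by (auto simp: lc_ge_iff intro: antisym)
  ultimately show ?thesis using m by (auto simp: lead_root_def hval_lc_nth)
qed

section \<open>Initial forms and lifting of roots\<close>

text \<open>g is the residue of \<open>t^(-m) Q(t^l x)\<close>, whose coefficients have nonnegative valuation; it is the
  initial form of Q at l unless it vanishes.\<close>
definition init_form :: "real \<Rightarrow> real \<Rightarrow> lc poly \<Rightarrow> complex poly \<Rightarrow> bool" where
  "init_form l m Q g \<longleftrightarrow> (\<forall>k. lc_ge (m - real k * l) (coeff Q k) \<and>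
     coeff g k = lc_nth (coeff Q k) (m - real k * l))"

lemma init_form_add: "init_form l m Q g \<Longrightarrow> init_form l m R h \<Longrightarrow> init_form l m (Q + R) (g + h)"
  by (auto simp: init_form_def)

text \<open>Reduction to the lowest order is multiplicative, as in Gauss' lemma. This carries
  information from a polynomial to its divisors and from linear factors to their product.\<close>

lemma init_form_mult:
  assumes "init_form l m Q g" "init_form l n R h"
  shows "init_form l (m + n) (Q * R) (g * h)"
  unfolding init_form_def
proof (intro allI conjI)
  fix k
  have split: "m + n - real k * l = (m - real i * l) + (n - real (k - i) * l)" if "i \<le> k" for i
    using that by (simp add: of_nat_diff algebra_simps)
  have ge: "lc_ge (m + n - real k * l) (coeff Q i * coeff R (k - i))" if "i \<le> k" for i
    unfolding split[OF that] using assms by (intro lc_ge_mult) (auto simp: init_form_def)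
  then show "lc_ge (m + n - real k * l) (coeff (Q * R) k)"
    unfolding coeff_mult by (intro lc_ge_sum) auto
  have "lc_nth (coeff Q i * coeff R (k - i)) (m + n - real k * l) = coeff g i * coeff h (k - i)" if "i \<le> k" for i
    unfolding split[OF that] using assms by (subst lc_nth_mult_low) (auto simp: init_form_def)
  then show "coeff (g * h) k = lc_nth (coeff (Q * R) k) (m + n - real k * l)"
    unfolding coeff_mult lc_nth_sum by (intro sum.cong) auto
qed

lemma init_form_const: "lc_ge m c \<Longrightarrow> init_form l m [:c:] [:lc_nth c m:]"
  by (auto simp: init_form_def coeff_pCons split: nat.splits)

lemma init_form_unique:
  assumes "init_form l m Q g" "init_form l n Q h" "g \<noteq> 0" "h \<noteq> 0"
  shows "m = n \<and> g = h"
proof -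
  have less: "\<not> m < n" if *: "init_form l m Q g" "init_form l n Q h" "g \<noteq> 0" for m n g h
  proof
    assume "m < n"
    have "coeff g k = 0" for k
    proof -
      have "lc_ge (n - real k * l) (coeff Q k)" using * by (auto simp: init_form_def)
      then have "lc_nth (coeff Q k) (m - real k * l) = 0" using \<open>m < n\<close> by (auto simp: lc_ge_def)
      then show ?thesis using * by (auto simp: init_form_def)
    qed
    then show False using * by (auto intro: poly_eqI)
  qed
  have "m = n" using less[OF assms(1,2,3)] less[OF assms(2,1,4)] by simp
  moreover have "coeff g k = coeff h k" for k
    using assms \<open>m = n\<close> by (auto simp: init_form_def)
  ultimately show ?thesis by (auto intro: poly_eqI)
qed

lemma ex_init_form_poly:
  assumes "\<And>k. lc_ge (m - real k * l) (coeff Q k)"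
  shows "\<exists>g. init_form l m Q g"
proof -
  define g where "g = (\<Sum>k\<le>degree Q. monom (lc_nth (coeff Q k) (m - real k * l)) k)"
  have "coeff g k = lc_nth (coeff Q k) (m - real k * l)" for k
    by (cases "k \<le> degree Q") (auto simp: g_def coeff_sum coeff_eq_0)
  then show ?thesis using assms by (auto simp: init_form_def)
qed

lemma ex_init_form:
  assumes "Q \<noteq> 0"
  shows "\<exists>m g. init_form l m Q g \<and> g \<noteq> 0"
proof -
  define K where "K = {k. coeff Q k \<noteq> 0}"
  have "degree Q \<in> K" using assms by (simp add: K_def)
  then have K: "finite K" "K \<noteq> {}"
    using MOST_coeff_eq_0[of Q] by (simp add: K_def eventually_cofinite, blast)
  have "\<forall>k\<in>K. \<exists>v. lc_ge v (coeff Q k) \<and> lc_nth (coeff Q k) v \<noteq> 0"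
    unfolding K_def using lc_leading by (metis mem_Collect_eq)
  then obtain v where v: "\<And>k. k \<in> K \<Longrightarrow> lc_ge (v k) (coeff Q k)" "\<And>k. k \<in> K \<Longrightarrow> lc_nth (coeff Q k) (v k) \<noteq> 0"
    by metis
  define m where "m = Min ((\<lambda>k. v k + real k * l) ` K)"
  have "m \<in> (\<lambda>k. v k + real k * l) ` K" unfolding m_def using K by (intro Min_in) auto
  then obtain k where k: "k \<in> K" "m = v k + real k * l" by auto
  have "m \<le> v k + real k * l" if "k \<in> K" for k using K that by (auto simp: m_def)
  then have "lc_ge (m - real k * l) (coeff Q k)" for k
    using v(1)[of k] by (cases "k \<in> K") (auto simp: K_def algebra_simps intro: lc_ge_mono)
  then obtain g where g: "init_form l m Q g" using ex_init_form_poly by blast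
  moreover have "coeff g k \<noteq> 0" using g k v(2) by (auto simp: init_form_def)
  then have "g \<noteq> 0" by auto
  ultimately show ?thesis by blast
qed

text \<open>The value l is minus the slope of the first edge of the Newton polygon: by maximality no
  point lies below the line through (0, v 0), and the k attaining the maximum lies on it. The
  residue thus has nonzero coefficients at 0 and at k.\<close>

lemma ex_init_form_nonconstant:
  assumes "coeff Q 0 \<noteq> 0" "0 < degree Q"
  shows "\<exists>l m g. init_form l m Q g \<and> coeff g 0 \<noteq> 0 \<and> 0 < degree g"
proof -
  define K where "K = {k. 0 < k \<and> coeff Q k \<noteq> 0}"
  have fin: "finite K" 
    using MOST_coeff_eq_0[of Q] by (auto simp: K_def eventually_cofinite intro: finite_subset[rotated])
  have "degree Q \<in> K" using assms by (auto simp: K_def)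
  then have ne: "K \<noteq> {}" by auto
  have "\<forall>k. \<exists>v. coeff Q k \<noteq> 0 \<longrightarrow> lc_ge v (coeff Q k) \<and> lc_nth (coeff Q k) v \<noteq> 0"
    using lc_leading by metis
  then obtain v where v: "\<And>k. coeff Q k \<noteq> 0 \<Longrightarrow> lc_ge (v k) (coeff Q k)" 
    "\<And>k. coeff Q k \<noteq> 0 \<Longrightarrow> lc_nth (coeff Q k) (v k) \<noteq> 0"
    by metis
  define l where "l = Max ((\<lambda>k. (v 0 - v k) / real k) ` K)"
  have "l \<in> (\<lambda>k. (v 0 - v k) / real k) ` K" unfolding l_def using fin ne by (intro Max_in) auto
  then obtain k where k: "k \<in> K" "l = (v 0 - v k) / real k" by auto
  have "(v 0 - v k) / real k \<le> l" if "k \<in> K" for k using fin that by (auto simp: l_def)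
  then have le: "v 0 - real k * l \<le> v k" if "k \<in> K" for k
    using that by (auto simp: K_def field_simps)
  have "lc_ge (v 0 - real k * l) (coeff Q k)" for k
  proof (cases "k = 0 \<or> coeff Q k = 0")
    case False
    then show ?thesis using v(1)[of k] le[of k] by (auto simp: K_def intro: lc_ge_mono)
  qed (use v(1)[of 0] assms in auto)
  then obtain g where g: "init_form l (v 0) Q g" using ex_init_form_poly by blast
  have "coeff g 0 \<noteq> 0" using g v(2)[of 0] assms by (auto simp: init_form_def)
  moreover have "v 0 - real k * l = v k" using k by (auto simp: K_def)
  then have "coeff g k \<noteq> 0" using g v(2)[of k] k by (auto simp: init_form_def K_def)
  then have "0 < degree g" using le_degree[of g k] k by (auto simp: K_def)
  ultimately show ?thesis using g by blast
qed

section \<open>Contractions and Hensel's lemma\<close>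

lemma lc_ge_poly:
  assumes "\<And>k. lc_ge 0 (coeff F k)" "lc_ge 0 y"
  shows "lc_ge 0 (poly F y)"
  using assms
proof (induction F)
  case (pCons a F)
  have "lc_ge 0 (coeff F k)" for k using pCons.prems(1)[of "Suc k"] by simp
  then have "lc_ge (0 + 0) (y * poly F y)" using pCons by (intro lc_ge_mult) auto
  then show ?case using pCons.prems(1)[of 0] by auto
qed simp

lemma lc_ge_poly_diff:
  assumes "\<And>k. lc_ge 0 (coeff F k)" "lc_ge 0 y" "lc_ge 0 z" "lc_ge d (y - z)"
  shows "lc_ge d (poly F y - poly F z)"
  using assms
proof (induction F)
  case (pCons a F)
  have F: "lc_ge 0 (coeff F k)" for k using pCons.prems(1)[of "Suc k"] by simp
  have "lc_ge (d + 0) ((y - z) * poly F y)" using pCons F by (intro lc_ge_mult lc_ge_poly) auto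
  moreover have "lc_ge (0 + d) (z * (poly F y - poly F z))" using pCons F by (intro lc_ge_mult) auto
  moreover have "poly (pCons a F) y - poly (pCons a F) z = (y - z) * poly F y + z * (poly F y - poly F z)"
    by (simp add: algebra_simps)
  ultimately show ?case by auto
qed simp

lemma lc_complete:
  assumes "0 < e" "\<And>n. lc_ge (real (Suc n) * e) (Y (Suc n) - Y n)"
  shows "\<exists>y. \<forall>n. lc_ge (real (Suc n) * e) (y - Y n)"
proof -
  have Y: "lc_nth (Y m) x = lc_nth (Y n) x" if "n \<le> m" "x < real (Suc n) * e" for m n x
    using that(1)
  proof (induction rule: dec_induct)
    case (step m)
    have "real (Suc n) * e \<le> real (Suc m) * e" using step assms(1) by (intro mult_right_mono) auto
    then have "lc_nth (Y (Suc m) - Y m) x = 0" using assms(2)[of m] that(2) by (auto simp: lc_ge_def simp del: lc_nth_simps of_nat_Suc)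
    then show ?case using step by simp
  qed simp
  \<comment> \<open>Coefficients at x are stationary from any index n with x < (n + 1) e on; N x is
    one such index.\<close>
  define N where "N x = nat \<lceil>x / e\<rceil>" for x
  have N: "x < real (Suc (N x)) * e" for x
  proof -
    have "x / e \<le> real (N x)" unfolding N_def by linarith
    then show ?thesis using assms(1) by (simp add: field_simps)
  qed
  define f where "f x = lc_nth (Y (N x)) x" for x
  have f: "f x = lc_nth (Y n) x" if "x < real (Suc n) * e" for n x
    using Y[of n "max n (N x)" x] Y[of "N x" "max n (N x)" x] that N by (simp add: f_def)
  have "left_finite f"
    unfolding left_finite_def
  proof
    fix b
    have "f x = lc_nth (Y (N b)) x" if "x \<le> b" for x using f[of x "N b"] N[of b] that by simp
    then have "{x. x \<le> b \<and> f x \<noteq> 0} = {x. x \<le> b \<and> lc_nth (Y (N b)) x \<noteq> 0}" by auto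
    then show "finite {x. x \<le> b \<and> f x \<noteq> 0}"
      using left_finite_lc_nth[of "Y (N b)"] by (simp add: left_finite_def)
  qed
  then have "lc_nth (Abs_lc f) = f" by (simp add: Abs_lc_inverse)
  then have "lc_ge (real (Suc n) * e) (Abs_lc f - Y n)" for n
    unfolding lc_ge_def by (simp add: f del: of_nat_Suc)
  then show ?thesis by blast
qed

text \<open>Write G(y) = a + y H(y) with H(y) = b + y F(y). On the ball of valuation at least e both
  a and H(y) have valuation at least e, and H does not expand distances. So G maps the ball to
  itself, and differences gain e.\<close>

lemma lc_fixpoint:
  assumes "0 < e" "\<And>k. lc_ge 0 (coeff G k)" "lc_ge e (coeff G 0)" "lc_ge e (coeff G 1)"
  shows "\<exists>y. lc_ge e y \<and> poly G y = y"
proof -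
  obtain a b F where G: "G = pCons a (pCons b F)" by (metis pCons_cases)
  have ab: "lc_ge e a" "lc_ge e b" using assms by (auto simp: G)
  have F: "lc_ge 0 (coeff F k)" for k using assms(2)[of "Suc (Suc k)"] by (simp add: G)
  have bF: "lc_ge 0 (coeff (pCons b F) k)" for k using assms(2)[of "Suc k"] by (simp add: G)
  have ge0: "lc_ge 0 y" if "lc_ge e y" for y using that assms(1) by (auto intro: lc_ge_mono)
  have H: "lc_ge e (poly (pCons b F) y)" if y: "lc_ge e y" for y
  proof -
    have "lc_ge (e + 0) (y * poly F y)" using y ge0 F by (intro lc_ge_mult lc_ge_poly)
    then show ?thesis using ab by auto
  qed
  have diff: "lc_ge (d + e) (poly G y - poly G z)" if "lc_ge e y" "lc_ge e z" "lc_ge d (y - z)" for d y z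
  proof -
    have "lc_ge (d + e) ((y - z) * poly (pCons b F) y)" using that H by (intro lc_ge_mult)
    moreover have "lc_ge (e + d) (z * (poly (pCons b F) y - poly (pCons b F) z))"
      using that ge0 bF by (intro lc_ge_mult lc_ge_poly_diff)
    moreover have "poly G y - poly G z = (y - z) * poly (pCons b F) y + z * (poly (pCons b F) y - poly (pCons b F) z)"
      by (simp add: G algebra_simps)
    ultimately show ?thesis by (metis add.commute lc_ge_add)
  qed
  define Y where "Y n = (poly G ^^ n) 0" for n
  have YS: "Y (Suc n) = poly G (Y n)" for n by (simp add: Y_def)
  have Ye: "lc_ge e (Y n)" for n
  proof (induction n)
    case (Suc n)
    have "lc_ge (e + 0) (Y n * poly (pCons b F) (Y n))" 
      using Suc ge0 bF by (intro lc_ge_mult lc_ge_poly)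
    then show ?case using ab by (auto simp: YS G)
  qed (simp add: Y_def)
  have step: "lc_ge (real (Suc n) * e) (Y (Suc n) - Y n)" for n
  proof (induction n)
    case 0
    then show ?case using ab by (simp add: Y_def G)
  next
    case (Suc n)
    have "lc_ge (real (Suc n) * e + e) (poly G (Y (Suc n)) - poly G (Y n))"
      using Suc Ye by (intro diff)
    moreover have "real (Suc n) * e + e = real (Suc (Suc n)) * e" by (simp add: algebra_simps)
    ultimately show ?case by (simp only: YS)
  qed
  obtain y where y: "\<And>n. lc_ge (real (Suc n) * e) (y - Y n)" using lc_complete[OF assms(1) step] by blast
  have ye: "lc_ge e y"
  proof -
    have "lc_ge e (y - Y 0)" using y[of 0] by simp
    then have "lc_ge e (y - Y 0 + Y 0)" using Ye by (intro lc_ge_add)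
    then show ?thesis by simp
  qed
  have "lc_ge (real (Suc n) * e) (poly G y - y)" for n
  proof -
    have "lc_ge (real (Suc n) * e + e) (poly G y - poly G (Y n))" using ye Ye y by (intro diff)
    then have "lc_ge (real (Suc n) * e) (poly G y - Y (Suc n))"
      unfolding YS by (rule lc_ge_mono) (use assms(1) in simp)
    moreover have "lc_ge (real (Suc n) * e) (y - Y (Suc n))"
      using y[of "Suc n"] by (rule lc_ge_mono) (use assms(1) in \<open>simp add: field_simps\<close>)
    ultimately have "lc_ge (real (Suc n) * e) ((poly G y - Y (Suc n)) - (y - Y (Suc n)))" by (rule lc_ge_diff)
    then show ?thesis by simp
  qed
  moreover have "\<exists>n. x < real (Suc n) * e" for x
    using ex_less_of_nat_mult[OF assms(1), of x] by (metis Suc_leI gr0I less_imp_Suc_add assms(1) mult_zero_left of_nat_0 order_less_trans mult_pos_pos of_nat_0_less_iff zero_less_Suc)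
  ultimately have "lc_nth (poly G y - y) x = 0" for x unfolding lc_ge_def by metis
  then have "poly G y - y = 0" by (intro lc_eqI) simp
  then show ?thesis using ye by auto
qed

lemma lc_ge_pos:
  assumes "lc_ge 0 f" "lc_nth f 0 = 0"
  shows "\<exists>e>0. lc_ge e f"
proof (cases "f = 0")
  case False
  then obtain m where m: "lc_ge m f" "lc_nth f m \<noteq> 0" by (rule lc_leading)
  then have "0 \<le> m" "m \<noteq> 0" using assms by (auto simp: lc_ge_iff)
  then show ?thesis using m by (intro exI[of _ m]) auto
qed (auto intro: exI[of _ 1])

text \<open>Newton's iteration with frozen derivative: G(y) = y - Q(y) / g_1. The residues of its
  coefficients 0 and 1 vanish, so these have positive valuation and \<open>lc_fixpoint\<close>
  applies with the smaller of the two.\<close>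

lemma hensel_unit:
  assumes "init_form 0 0 Q g" "coeff g 0 = 0" "coeff g 1 \<noteq> 0"
  shows "\<exists>y. lc_ge 0 y \<and> lc_nth y 0 = 0 \<and> poly Q y = 0"
proof -
  define a where "a = monom_lc (1 / coeff g 1) 0"
  define G where "G = [:0, 1:] - smult a Q"
  have Q: "lc_ge 0 (coeff Q k)" "lc_nth (coeff Q k) 0 = coeff g k" for k
    using assms(1) by (auto simp: init_form_def)
  have aQ: "lc_ge (0 + 0) (a * coeff Q k)" "lc_nth (a * coeff Q k) (0 + 0) = coeff g k / coeff g 1" for k
    using lc_ge_mult[of 0 a 0 "coeff Q k"] lc_nth_mult_low[of 0 a 0 "coeff Q k"] Q[of k]
    by (simp_all add: a_def)
  have "lc_ge 0 (coeff [:0, 1 :: lc:] k)" for k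
    by (auto simp: coeff_pCons one_lc_def split: nat.splits)
  then have G0: "lc_ge 0 (coeff G k)" for k using aQ(1)[of k] by (auto simp: G_def)
  have "lc_nth (coeff G 0) 0 = 0" "lc_nth (coeff G 1) 0 = 0"
    using aQ(2)[of 0] aQ(2)[of 1] assms by (auto simp: G_def)
  then obtain e1 e2 where "0 < e1" "0 < e2" "lc_ge e1 (coeff G 0)" "lc_ge e2 (coeff G 1)"
    using lc_ge_pos G0 by meson
  then have e: "0 < min e1 e2" "lc_ge (min e1 e2) (coeff G 0)" "lc_ge (min e1 e2) (coeff G 1)"
    by (auto intro: lc_ge_mono)
  from lc_fixpoint[OF e(1) G0 e(2,3)] obtain y where y: "lc_ge (min e1 e2) y" "poly G y = y" by blast
  have "a * poly Q y = 0" using y(2) by (simp add: G_def)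
  moreover have "a \<noteq> 0" using assms(3) by (simp add: a_def)
  moreover have "lc_ge 0 y" "lc_nth y 0 = 0" using y(1) e(1) by (auto simp: lc_ge_def)
  ultimately show ?thesis by auto
qed

lemma init_form_pcompose:
  assumes "init_form 0 0 Q g" "init_form 0 0 R h"
  shows "init_form 0 0 (pcompose Q R) (pcompose g h)"
  using assms(1)
proof (induction Q arbitrary: g)
  case 0
  then have "g = 0" by (auto simp: init_form_def intro: poly_eqI)
  then show ?case by (simp add: init_form_def)
next
  case (pCons a Q)
  obtain b g' where g: "g = pCons b g'" by (metis pCons_cases)
  have *: "lc_ge 0 (coeff (pCons a Q) k)" "coeff g k = lc_nth (coeff (pCons a Q) k) 0" for k
    using pCons.prems by (auto simp: init_form_def)
  have a: "lc_ge 0 a" "b = lc_nth a 0" using *[of 0] by (auto simp: g)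
  have "init_form 0 0 Q g'"
    unfolding init_form_def using *[of "Suc k" for k] by (auto simp: g)
  then have "init_form 0 (0 + 0) (R * pcompose Q R) (h * pcompose g' h)"
    using assms(2) pCons.IH by (intro init_form_mult)
  moreover have "init_form 0 0 [:a:] [:b:]" using init_form_const[OF a(1)] a(2) by simp
  ultimately show ?case unfolding g pcompose_pCons using init_form_add by simp
qed

text \<open>Substituting t^l x, scaling by t^(-m) and translating by z moves the simple root z of
  the residue to 0.\<close>

lemma hensel:
  assumes "init_form l m Q g" "poly g z = 0" "poly (pderiv g) z \<noteq> 0"
  shows "\<exists>r. poly Q r = 0 \<and> lc_ge l r \<and> lc_nth r l = z"
proof -
  define Q1 where "Q1 = smult (monom_lc 1 (- m)) (pcompose Q [:0, monom_lc 1 l:])"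
  define Q2 where "Q2 = pcompose Q1 [:monom_lc z 0, 1:]"
  have "init_form 0 0 Q1 g"
    unfolding init_form_def
  proof
    fix k
    have c: "coeff Q1 k = monom_lc 1 (real k * l - m) * coeff Q k"
      unfolding Q1_def by (simp add: coeff_pcompose_linear monom_lc_power mult.assoc[symmetric] monom_lc_mult)
    have Q: "lc_ge (m - real k * l) (coeff Q k)" "coeff g k = lc_nth (coeff Q k) (m - real k * l)"
      using assms(1) by (auto simp: init_form_def)
    have m1: "lc_ge (real k * l - m) (monom_lc 1 (real k * l - m))" by simp
    show "lc_ge (0 - real k * 0) (coeff Q1 k) \<and> coeff g k = lc_nth (coeff Q1 k) (0 - real k * 0)"
      unfolding c using lc_ge_mult[OF m1 Q(1)] lc_nth_mult_low[OF m1 Q(1)] Q(2) by simp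
  qed
  moreover have "init_form 0 0 [:monom_lc z 0, 1:] [:z, 1:]"
    by (auto simp: init_form_def coeff_pCons one_lc_def split: nat.splits)
  ultimately have "init_form 0 0 Q2 (pcompose g [:z, 1:])"
    unfolding Q2_def by (rule init_form_pcompose)
  moreover have "coeff (pcompose g [:z, 1:]) 0 = 0" using assms(2) by simp
  moreover have "coeff (pcompose g [:z, 1:]) 1 = poly (pderiv (pcompose g [:z, 1:])) 0"
    by (simp add: poly_0_coeff_0 coeff_pderiv)
  then have "coeff (pcompose g [:z, 1:]) 1 \<noteq> 0"
    using assms(3) by (simp add: pderiv_pcompose poly_pcompose pderiv_pCons)
  ultimately obtain y where y: "lc_ge 0 y" "lc_nth y 0 = 0" "poly Q2 y = 0"
    using hensel_unit by blast
  define r where "r = monom_lc 1 l * (monom_lc z 0 + y)"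
  have "monom_lc 1 (- m) * poly Q r = 0"
    using y(3) by (simp add: Q2_def Q1_def poly_pcompose r_def algebra_simps)
  moreover have "monom_lc 1 (- m) \<noteq> 0" by simp
  ultimately have "poly Q r = 0" by simp
  moreover have "lc_ge 0 (monom_lc z 0 + y)" using y(1) by auto
  then have "lc_ge (l + 0) r" "lc_nth r (l + 0) = lc_nth (monom_lc 1 l) l * lc_nth (monom_lc z 0 + y) 0"
    unfolding r_def by (intro lc_ge_mult lc_nth_mult_low; simp)+
  ultimately show ?thesis using y(2) by auto
qed

section \<open>Splitting and the count of roots by leading term\<close>

text \<open>Quotients by found roots remain divisors of P, while their initial forms are factors of
  those of P. A nonzero complex root of such a factor is therefore simple and lifts; a root 0 of Q
  is split off directly.\<close>

lemma dvd_splits: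
  assumes simple: "\<And>l m g. init_form l m P g \<Longrightarrow> g \<noteq> 0 \<Longrightarrow> simple_nz_roots g"
    and "Q dvd P" "P \<noteq> 0"
  shows "\<exists>c rs. c \<noteq> 0 \<and> Q = smult c (\<Prod>r\<leftarrow>rs. [:- r, 1:])"
  using assms(2)
proof (induction "degree Q" arbitrary: Q rule: less_induct)
  case less
  have Q0: "Q \<noteq> 0" using less.prems assms(3) by auto
  show ?case
  proof (cases "degree Q = 0")
    case True
    then obtain c where "Q = [:c:]" using degree_0_id by metis
    then show ?thesis using Q0 by (intro exI[of _ c] exI[of _ "[]"]) auto
  next
    case False
    have "\<exists>r. poly Q r = 0"
    proof (cases "coeff Q 0 = 0")
      case True
      then show ?thesis by (auto simp: poly_0_coeff_0 intro: exI[of _ 0])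
    next
      case c0: False
      obtain l m g where g: "init_form l m Q g" "coeff g 0 \<noteq> 0" "0 < degree g"
        using ex_init_form_nonconstant[OF c0] False by blast
      have "\<not> constant (poly g)" using g(3) by (simp add: constant_degree)
      then obtain z where z: "poly g z = 0" using fundamental_theorem_of_algebra by blast
      then have "z \<noteq> 0" using g(2) by (auto simp: poly_0_coeff_0)
      obtain R where R: "P = Q * R" using less.prems by auto
      then have "R \<noteq> 0" using assms(3) by auto
      then obtain n h where h: "init_form l n R h" "h \<noteq> 0" using ex_init_form by blast
      have "g \<noteq> 0" using g(2) by auto
      then have "simple_nz_roots (g * h)"
        using simple[of l "m + n" "g * h"] init_form_mult[OF g(1) h(1)] h(2) R by simp
      then have "poly (pderiv (g * h)) z \<noteq> 0" using z \<open>z \<noteq> 0\<close> by (simp add: simple_nz_roots_def)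
      \<comment> \<open>Since g vanishes at z, the derivative of g * h there is g'(z) h(z).\<close>
      then have "poly (pderiv g) z \<noteq> 0" using z by (auto simp: pderiv_mult)
      then show ?thesis using hensel[OF g(1) z] by blast
    qed
    then obtain r where "poly Q r = 0" by blast
    then obtain Q' where Q': "Q = [:- r, 1:] * Q'" by (auto simp: poly_eq_0_iff_dvd)
    then have "Q' \<noteq> 0" using Q0 by auto
    then have "degree Q' < degree Q" unfolding Q' by (subst degree_mult_eq) auto
    moreover have "Q' dvd P" using less.prems Q' by (metis dvd_mult_right)
    ultimately obtain c rs where "c \<noteq> 0" "Q' = smult c (\<Prod>r\<leftarrow>rs. [:- r, 1:])"
      using less.hyps by blast
    then show ?thesis using Q' by (intro exI[of _ c] exI[of _ "r # rs"]) (simp add: mult_smult_right)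
  qed
qed

definition root_coeffs :: "real \<Rightarrow> lc list \<Rightarrow> complex list" where
  "root_coeffs l rs = map (\<lambda>r. lc_nth r l) (filter (\<lambda>r. lc_ge l r \<and> lc_nth r l \<noteq> 0) rs)"

text \<open>A root of valuation l leaves the factor x minus its leading coefficient; one of larger
  valuation, or 0, leaves x, and one of smaller valuation a nonzero constant.\<close>

lemma init_form_linear:
  "\<exists>m h. init_form l m [:- r, 1:] h \<and>
     (if lc_ge l r \<and> lc_nth r l \<noteq> 0 then h = [:- lc_nth r l, 1:]
      else (\<exists>c a. c \<noteq> 0 \<and> h = monom c a))"
proof (cases "lc_ge l r")
  case True
  have "init_form l l [:- r, 1:] [:- lc_nth r l, 1:]"
    using True by (auto simp: init_form_def coeff_pCons one_lc_def split: nat.splits)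
  moreover have "[:0, 1:] = monom (1::complex) 1" by (simp add: monom_altdef)
  ultimately have "\<exists>c a. c \<noteq> 0 \<and> [:- lc_nth r l, 1:] = monom c a" if "lc_nth r l = 0"
    using that by (intro exI[of _ 1] exI[of _ "1::nat"]) simp
  then show ?thesis using True \<open>init_form l l [:- r, 1:] [:- lc_nth r l, 1:]\<close>
    by (intro exI[of _ l] exI[of _ "[:- lc_nth r l, 1:]"]) (simp del: ex_simps)
next
  case False
  then have "r \<noteq> 0" by auto
  then obtain m where m: "lc_ge m r" "lc_nth r m \<noteq> 0" by (rule lc_leading)
  have "m < l" using False m(1) by (auto intro: lc_ge_mono simp: not_le[symmetric])
  then have "init_form l m [:- r, 1:] (monom (- lc_nth r m) 0)"
    using m by (auto simp: init_form_def coeff_pCons one_lc_def split: nat.splits)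
  moreover have "- lc_nth r m \<noteq> 0" using m(2) by simp
  ultimately show ?thesis using False by metis
qed

lemma init_form_prod:
  "\<exists>m c a. c \<noteq> 0 \<and> init_form l m (\<Prod>r\<leftarrow>rs. [:- r, 1:]) (monom c a * (\<Prod>z\<leftarrow>root_coeffs l rs. [:- z, 1:]))"
proof (induction rs)
  case Nil
  have "init_form l 0 1 [:1:]" using init_form_const[of 0 1 l] by (simp add: one_lc_def one_pCons)
  then show ?case by (intro exI[of _ 0] exI[of _ 1] exI[of _ "0::nat"]) (simp add: root_coeffs_def monom_altdef one_pCons)
next
  case (Cons r rs)
  then obtain m c a where c: "c \<noteq> 0" 
    "init_form l m (\<Prod>r\<leftarrow>rs. [:- r, 1:]) (monom c a * (\<Prod>z\<leftarrow>root_coeffs l rs. [:- z, 1:]))" by blast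
  obtain n h where h: "init_form l n [:- r, 1:] h"
     "if lc_ge l r \<and> lc_nth r l \<noteq> 0 then h = [:- lc_nth r l, 1:]
      else (\<exists>c a. c \<noteq> 0 \<and> h = monom c a)" using init_form_linear by blast
  have *: "init_form l (n + m) (\<Prod>r\<leftarrow>r # rs. [:- r, 1:]) (h * (monom c a * (\<Prod>z\<leftarrow>root_coeffs l rs. [:- z, 1:])))"
    using init_form_mult[OF h(1) c(2)] by simp
  show ?case
  proof (cases "lc_ge l r \<and> lc_nth r l \<noteq> 0")
    case True
    then have "h * (monom c a * (\<Prod>z\<leftarrow>root_coeffs l rs. [:- z, 1:])) =
        monom c a * (\<Prod>z\<leftarrow>root_coeffs l (r # rs). [:- z, 1:])"
      using h(2) by (simp only: root_coeffs_def filter.simps if_True list.map prod_list.Cons mult_ac simp_thms)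
    then show ?thesis using * c(1) by metis
  next
    case False
    then obtain d b where d: "d \<noteq> 0" "h = monom d b" using h(2) by auto
    have "h * (monom c a * (\<Prod>z\<leftarrow>root_coeffs l rs. [:- z, 1:])) =
        monom (d * c) (b + a) * (\<Prod>z\<leftarrow>root_coeffs l (r # rs). [:- z, 1:])"
      using False by (auto simp: d(2) root_coeffs_def mult.assoc[symmetric] mult_monom)
    moreover have "d * c \<noteq> 0" using d c by simp
    ultimately show ?thesis using * by metis
  qed
qed

text \<open>By uniqueness g is a nonzero constant times a power of x times the product of all x - z,
  with z the leading coefficients of the roots of valuation l. Simplicity makes the z distinct, so
  the length of a list equals the size of a set.\<close>

lemma root_count:
  assumes "init_form l m (smult c (\<Prod>r\<leftarrow>rs. [:- r, 1:])) g" "g \<noteq> 0" "c \<noteq> 0" "simple_nz_roots g"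
  shows "length (filter (\<lambda>r. lead_root (lc_nth r) l L) rs) = card {z. z \<noteq> 0 \<and> poly g z = 0 \<and> L z}"
proof -
  obtain n d a where d: "d \<noteq> 0" 
    "init_form l n (\<Prod>r\<leftarrow>rs. [:- r, 1:]) (monom d a * (\<Prod>z\<leftarrow>root_coeffs l rs. [:- z, 1:]))" 
    using init_form_prod by blast
  obtain v where v: "lc_ge v c" "lc_nth c v \<noteq> 0" using lc_leading[OF assms(3)] by blast
  define h where "h = [:lc_nth c v:] * (monom d a * (\<Prod>z\<leftarrow>root_coeffs l rs. [:- z, 1:]))"
  have "init_form l (v + n) (smult c (\<Prod>r\<leftarrow>rs. [:- r, 1:])) h"
    unfolding h_def using init_form_mult[OF init_form_const[OF v(1)] d(2)] by simp
  moreover have "h \<noteq> 0" using v(2) d(1) by (auto simp: h_def prod_list_zero_iff)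
  ultimately have gh: "g = h" using init_form_unique[OF assms(1)] assms(2) by blast
  define zs where "zs = root_coeffs l rs"
  have nz: "0 \<notin> set zs" by (auto simp: zs_def root_coeffs_def)
  have pz: "poly (\<Prod>z\<leftarrow>zs. [:- z, 1:]) w = 0 \<longleftrightarrow> w \<in> set zs" for w
    by (induction zs) auto
  have roots: "{z. z \<noteq> 0 \<and> poly g z = 0} = set zs"
    using nz v(2) d(1) unfolding gh h_def zs_def[symmetric]
    by (auto simp: pz poly_monom)
  have "distinct zs"
  proof (rule ccontr)
    assume "\<not> distinct zs"
    then obtain xs ys us z where z: "zs = xs @ [z] @ ys @ [z] @ us" using not_distinct_decomp by blast
    define q where "q = [:lc_nth c v:] * monom d a * (\<Prod>z\<leftarrow>xs @ ys @ us. [:- z, 1:])"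
    have "g = [:- z, 1:] * ([:- z, 1:] * q)"
      unfolding gh h_def zs_def[symmetric] z q_def by (simp only: map_append prod_list.append list.map prod_list.Cons prod_list.Nil mult_ac mult_1)
    then have "poly (pderiv g) z = 0" "poly g z = 0"
      by (simp_all only: pderiv_mult poly_mult poly_add) simp_all
    moreover have "z \<noteq> 0" using nz z by auto
    ultimately show False using assms(4) by (simp add: simple_nz_roots_def)
  qed
  have "length (filter (\<lambda>r. lead_root (lc_nth r) l L) rs) = length (filter L zs)"
    unfolding zs_def root_coeffs_def
    by (simp add: lead_root_iff filter_map o_def conj_assoc) 
  also have "\<dots> = card (set (filter L zs))" using \<open>distinct zs\<close> by (intro distinct_card[symmetric] distinct_filter)
  also have "set (filter L zs) = {z. z \<noteq> 0 \<and> poly g z = 0 \<and> L z}" using roots by auto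
  finally show ?thesis .
qed

section \<open>Choice of P and count of its roots\<close>

lemma pcoeff_lin_mult:
  assumes "\<And>k. pcoeff cs k = lc_nth (coeff Q k)"
  shows "pcoeff (lin_mult (lc_nth r) cs) k = lc_nth (coeff ([:- r, 1:] * Q) k)"
proof (cases "k < Suc (length cs)")
  case True
  then have "pcoeff (lin_mult (lc_nth r) cs) k =
     (\<lambda>x. (if k = 0 then 0 else pcoeff cs (k - 1) x) - hmul (lc_nth r) (pcoeff cs k) x)"
    by (subst pcoeff_def, cases "k = 0") (simp_all add: lin_mult_def nth_map_upt del: upt_Suc)
  also have "\<dots> = (\<lambda>x. (if k = 0 then 0 else lc_nth (coeff Q (k - 1)) x) - lc_nth (r * coeff Q k) x)"
    by (cases "k = 0") (simp_all add: assms hmul_lc_nth)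
  also have "\<dots> = lc_nth (coeff ([:- r, 1:] * Q) k)"
    by (cases k) auto
  finally show ?thesis .
next
  case False
  have "lc_nth (coeff Q j) = lc_nth 0" if "length cs \<le> j" for j
    using assms[of j] that by (simp add: pcoeff_def fun_eq_iff)
  then have "coeff Q j = 0" if "length cs \<le> j" for j using that by (simp add: lc_nth_inject)
  then have "coeff ([:- r, 1:] * Q) k = 0" using False by (cases k) auto
  then show ?thesis using False by (auto simp: pcoeff_def lin_mult_def)
qed

lemma pcoeff_linprod:
  "pcoeff (linprod (map lc_nth rs)) k = lc_nth (coeff (\<Prod>r\<leftarrow>rs. [:- r, 1:]) k)"
proof (induction rs arbitrary: k)
  case Nil
  show ?case by (cases k) (auto simp: linprod_def pcoeff_def hone_def)
next
  case (Cons r rs)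
  show ?case using pcoeff_lin_mult[OF Cons.IH, of r k] by (simp add: linprod_def)
qed

lemma poly_cpoly: "poly (cpoly f) (of_real x) = of_real (poly f x)"
  by (induction f) (auto simp: map_poly_pCons)

lemma card_real_roots_cpoly:
  assumes "\<not> R 0"
  shows "card {z. z \<noteq> 0 \<and> poly (cpoly f) z = 0 \<and> Im z = 0 \<and> R (Re z)} = card {x. R x \<and> poly f x = 0}"
proof (rule bij_betw_same_card[of Re])
  have "poly (cpoly f) z = of_real (poly f (Re z))" if "Im z = 0" for z
  proof -
    have "of_real (Re z) = z" using that by (simp add: complex_eq_iff)
    then show ?thesis using poly_cpoly[of f "Re z"] by simp
  qed
  then show "bij_betw Re {z. z \<noteq> 0 \<and> poly (cpoly f) z = 0 \<and> Im z = 0 \<and> R (Re z)} {x. R x \<and> poly f x = 0}"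
    using assms by (intro bij_betwI[where g = of_real]) (auto simp: complex_eq_iff poly_cpoly)
qed

lemma lsign_tneg: "lsign m (tneg x) = - lsign m x"
  by (cases x) (auto split: sgn.splits)

lemma tval_ge_tneg: "tval_ge m (tneg x) = tval_ge m x"
  by (cases x) auto

theorem theorem5p4:
  fixes p :: "trh list"
  shows "\<exists>P :: (real \<Rightarrow> real) list.
           length P = length p \<and>
           (\<forall>i<length P. hahn (P ! i) \<and> vR (P ! i) = p ! i) \<and>
           (\<exists>c rs. hahn c \<and> (\<forall>r\<in>set rs. hahn r) \<and> splits_as (map cplx P) c rs \<and>
              (\<forall>i j. newton_edge P i j \<longrightarrow>
                 (let a = TFin Pos (- newton_slope P i j) in
                    length (filter (\<lambda>r. lead_root r (- newton_slope P i j)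
                                          (\<lambda>z. Im z = 0 \<and> Re z > 0)) rs) = tmult p a \<and>
                    length (filter (\<lambda>r. lead_root r (- newton_slope P i j)
                                          (\<lambda>z. Im z = 0 \<and> Re z < 0)) rs) = tmult (tneg_var p) a)))"
proof -
  define n where "n = length p"
  \<comment> \<open>The signs of p, with 1 as default at \<open>TInf\<close> because the coefficient
    lemma asks for nonzero values.\<close>
  define t :: "nat \<Rightarrow> real" where "t k = (case p ! k of TFin Neg _ \<Rightarrow> -1 | _ \<Rightarrow> 1)" for k
  have "t k \<noteq> 0" for k by (auto simp: t_def split: trh.splits sgn.splits)
  from ex_sharp_coefficients[of t n, OF this] obtain c where ct: "\<And>k. 0 < c k * t k"
    and sharp: "\<And>A. A \<subseteq> {..<n} \<Longrightarrow> A \<noteq> {} \<Longrightarrow>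
      simple_nz_roots (cpoly (subsum c A)) \<and>
      card {x. 0 < x \<and> poly (subsum c A) x = 0} = sign_changes 0 (restr c A n) \<and>
      card {x. x < 0 \<and> poly (subsum c A) x = 0} = sign_changes 0 (restr (\<lambda>k. (-1) ^ k * c k) A n)"
    by blast
  have c0: "c k \<noteq> 0" for k using ct[of k] by auto
  define f where "f k = (case p ! k of TInf \<Rightarrow> (\<lambda>_. 0) | TFin s v \<Rightarrow> (\<lambda>x. if x = v then c k else 0))" for k
  define P where "P = map f [0..<n]"
  define M where "M k = (case p ! k of TInf \<Rightarrow> 0 | TFin s v \<Rightarrow> monom_lc (of_real (c k)) v)" for k
  define Q where "Q = (\<Sum>k<n. monom (M k) k)"
  \<comment> \<open>The indices of the points of p on the line of slope - l and height m at 0; they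
    support the residue of Q at this level.\<close>
  define A where "A l m = {k. k < n \<and> (\<exists>s. p ! k = TFin s (m - real k * l))}" for l m
  have lenP: "length P = n" by (simp add: P_def)
  have Pk: "P ! k = (case p ! k of TInf \<Rightarrow> (\<lambda>_. 0) | TFin s v \<Rightarrow> (\<lambda>x. if x = v then c k else 0))" if "k < n" for k
    using that unfolding f_def[symmetric] by (simp add: P_def)
  have cQ: "coeff Q k = (if k < n then M k else 0)" for k
    by (simp add: Q_def coeff_sum)
  have hval: "hval (P ! k) = v" if "k < n" "p ! k = TFin s v" for k s v
    using that c0[of k] unfolding hval_def Pk[OF that(1)] by (auto intro!: Least_equality split: if_splits)
  have P0: "P ! k = (\<lambda>_. 0) \<longleftrightarrow> p ! k = TInf" if "k < n" for k
    using that c0[of k] unfolding Pk[OF that] by (auto simp: fun_eq_iff split: trh.splits)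
  have vP: "hahn (P ! k) \<and> vR (P ! k) = p ! k" if k: "k < n" for k
  proof (cases "p ! k")
    case TInf
    then show ?thesis using P0[OF k] by (simp add: vR_def hahn_def)
  next
    case (TFin s v)
    have "left_finite (P ! k)" unfolding left_finite_def Pk[OF k] TFin
      by (auto intro: finite_subset[of _ "{v}"])
    moreover have "(if c k > 0 then Pos else Neg) = s"
      using ct[of k] TFin by (cases s) (auto simp: t_def)
    moreover have "(P ! k) v = c k" using Pk[OF k] TFin by simp
    ultimately show ?thesis using P0[OF k] TFin hval[OF k TFin] by (simp add: vR_def left_finite_hahn)
  qed
  have cplxP: "pcoeff (map cplx P) k = lc_nth (coeff Q k)" for k
  proof (cases "k < n")
    case True
    then show ?thesis using Pk[OF True]
      by (cases "p ! k") (auto simp: pcoeff_def lenP cQ M_def cplx_def fun_eq_iff)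
  qed (auto simp: pcoeff_def lenP cQ fun_eq_iff)
  have fin: "finite (A l m)" "A l m \<subseteq> {..<n}" for l m by (auto simp: A_def)
  have init: "g = cpoly (subsum c (A l m))" if "init_form l m Q g" for l m g
  proof (rule poly_eqI)
    fix k
    have "coeff g k = lc_nth (coeff Q k) (m - real k * l)" using that by (simp add: init_form_def)
    also have "\<dots> = (if k \<in> A l m then of_real (c k) else 0)"
      by (cases "p ! k") (auto simp: cQ M_def A_def)
    also have "\<dots> = coeff (cpoly (subsum c (A l m))) k"
      by (simp add: coeff_map_poly coeff_subsum fin)
    finally show "coeff g k = coeff (cpoly (subsum c (A l m))) k" .
  qed
  have simple: "simple_nz_roots g" if "init_form l m Q g" "g \<noteq> 0" for l m g
  proof -
    have "A l m \<noteq> {}" using init[OF that(1)] that(2) by (auto simp: subsum_def)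
    then show ?thesis using sharp[OF fin(2)] init[OF that(1)] by auto
  qed
  have "\<exists>d rs. hahn d \<and> (\<forall>r\<in>set rs. hahn r) \<and> splits_as (map cplx P) d rs \<and>
      (\<forall>i j l. newton_edge P i j \<longrightarrow> l = - newton_slope P i j \<longrightarrow>
        length (filter (\<lambda>r. lead_root r l (\<lambda>z. Im z = 0 \<and> 0 < Re z)) rs) = tmult p (TFin Pos l) \<and>
        length (filter (\<lambda>r. lead_root r l (\<lambda>z. Im z = 0 \<and> Re z < 0)) rs) = tmult (tneg_var p) (TFin Pos l))"
  proof (cases "Q = 0")
    case True
    then have "p ! k = TInf" if "k < n" for k
      using cQ[of k] that c0[of k] by (cases "p ! k") (auto simp: M_def)
    then have "\<not> newton_edge P i j" for i j
      using P0 by (auto simp: newton_edge_def lenP)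
    \<comment> \<open>The zero polynomial splits with constant factor 0 and no roots, and it has no
      edges.\<close>
    moreover have "splits_as (map cplx P) (\<lambda>_. 0) []"
      unfolding splits_as_def cplxP True by (auto simp: hmul_def fun_eq_iff)
    moreover have "hahn (\<lambda>_. 0 :: complex)" by (simp add: hahn_def)
    ultimately show ?thesis by (intro exI[of _ "\<lambda>_. 0"] exI[of _ "[]"]) simp
  next
    case False
    have "\<exists>d rs. d \<noteq> 0 \<and> Q = smult d (\<Prod>r\<leftarrow>rs. [:- r, 1:])"
    proof (rule dvd_splits)
      show "simple_nz_roots g" if "init_form l m Q g" "g \<noteq> 0" for l m g
        using that by (rule simple)
    qed (use False in simp_all)
    then obtain d rs where d: "d \<noteq> 0" "Q = smult d (\<Prod>r\<leftarrow>rs. [:- r, 1:])" by (elim exE conjE)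
    have "splits_as (map cplx P) (lc_nth d) (map lc_nth rs)"
      unfolding splits_as_def cplxP pcoeff_linprod hmul_lc_nth by (simp add: d(2))
    moreover have "length (filter (\<lambda>r. lead_root r l (\<lambda>z. Im z = 0 \<and> 0 < Re z)) (map lc_nth rs)) = tmult p (TFin Pos l) \<and>
      length (filter (\<lambda>r. lead_root r l (\<lambda>z. Im z = 0 \<and> Re z < 0)) (map lc_nth rs)) = tmult (tneg_var p) (TFin Pos l)"
      if edge: "newton_edge P i j" and l: "l = - newton_slope P i j" for i j l
    proof -
      \<comment> \<open>The height at 0 of the line through the edge, whose slope is - l; the weight
        m - k l is its height at k.\<close>
      define m where "m = hval (P ! i) + real i * l"
      have i: "i < n" "p ! i \<noteq> TInf" using edge P0 lenP by (auto simp: newton_edge_def)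
      then obtain s v where iv: "p ! i = TFin s v" by (cases "p ! i") auto
      have "i \<in> A l m" using i iv hval[OF i(1) iv] by (auto simp: A_def m_def)
      then have A: "A l m \<noteq> {}" by auto
      have ge: "m - real k * l \<le> v" if "k < n" "p ! k = TFin s v" for k s v
      proof -
        have "hval (P ! i) + newton_slope P i j * (real k - real i) \<le> hval (P ! k)"
          using edge that P0 lenP by (auto simp: newton_edge_def)
        then show ?thesis using hval[OF that] by (simp add: m_def l algebra_simps)
      qed
      have "lc_ge (m - real k * l) (coeff Q k)" for k
        using ge[of k] by (cases "p ! k") (auto simp: cQ M_def)
      then obtain g where g: "init_form l m Q g" using ex_init_form_poly by blast
      have geq: "g = cpoly (subsum c (A l m))" using init[OF g] .
      have "coeff (subsum c (A l m)) i \<noteq> 0" using \<open>i \<in> A l m\<close> c0 by (simp add: coeff_subsum fin)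
      then have "g \<noteq> 0" unfolding geq by (auto simp: map_poly_eq_0_iff)
      note count = root_count[OF g[unfolded d(2)] \<open>g \<noteq> 0\<close> d(1) simple[OF g \<open>g \<noteq> 0\<close>]]
      have lev: "sgn (lsign (m - real k * l) (p ! k)) = sgn (if k \<in> A l m then c k else 0)" if "k < n" for k
        using ct[of k] that by (cases "p ! k") (auto simp: A_def t_def split: sgn.splits)
      have len': "length (tneg_var p) = n" by (simp add: tneg_var_def n_def)
      have neg: "tneg_var p ! k = (if even k then p ! k else tneg (p ! k))" if "k < n" for k
        using that by (simp add: tneg_var_def n_def)
      have w: "weights_ge l m p" "weights_ge l m (tneg_var p)"
        unfolding weights_ge_iff len' n_def[symmetric]
      proof -
        have "tval_ge (m - real k * l) (p ! k)" if "k < n" for k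
          using ge[OF that] by (cases "p ! k") auto
        then show "\<forall>k<n. tval_ge (m - real k * l) (p ! k)" "\<forall>k<n. tval_ge (m - real k * l) (tneg_var p ! k)"
          by (auto simp: neg tval_ge_tneg)
      qed
      have s1: "sign_changes 0 (levels l m p) = sign_changes 0 (restr c (A l m) n)"
        unfolding levels_eq_map restr_def n_def[symmetric]
        by (rule sign_changes_sgn_cong) (auto simp: lev)
      have s2: "sign_changes 0 (levels l m (tneg_var p)) = sign_changes 0 (restr (\<lambda>k. (-1) ^ k * c k) (A l m) n)"
        unfolding levels_eq_map restr_def len'
      proof (rule sign_changes_sgn_cong)
        have "sgn (lsign (m - real k * l) (tneg_var p ! k)) = sgn (if k \<in> A l m then (-1) ^ k * c k else 0)" if "k < n" for k
          using lev[OF that] by (auto simp: neg[OF that] lsign_tneg sgn_minus split: if_splits)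
        then show "map sgn (map (\<lambda>k. lsign (m - real k * l) (tneg_var p ! k)) [0..<n]) =
           map sgn (map (\<lambda>k. if k \<in> A l m then (- 1) ^ k * c k else 0) [0..<n])" by simp
      qed simp
      have l1: "lsign (m - real i * l) (p ! i) \<noteq> 0" using lev[OF i(1)] \<open>i \<in> A l m\<close> c0[of i] by (auto simp: sgn_0_0)
      then have n1: "\<exists>x\<in>set (levels l m p). x \<noteq> 0" 
        using i(1) by (auto simp: levels_eq_map n_def)
      have n2: "\<exists>x\<in>set (levels l m (tneg_var p)). x \<noteq> 0" 
        using i(1) l1 neg[OF i(1)] by (cases "even i") (auto simp: levels_eq_map len' lsign_tneg intro!: bexI[of _ i])
      show ?thesis
        unfolding tmult_eq_sign_changes[OF w(1) n1] tmult_eq_sign_changes[OF w(2) n2] s1 s2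
        using sharp[OF fin(2) A] count[of "\<lambda>z. Im z = 0 \<and> 0 < Re z"] count[of "\<lambda>z. Im z = 0 \<and> Re z < 0"]
          card_real_roots_cpoly[of "\<lambda>x. 0 < x" "subsum c (A l m)"] card_real_roots_cpoly[of "\<lambda>x. x < 0" "subsum c (A l m)"]
        by (simp add: filter_map o_def geq)
    qed
    moreover have "hahn (lc_nth d)" "\<forall>r\<in>set (map lc_nth rs). hahn r" by (simp_all add: left_finite_hahn)
    ultimately show ?thesis by blast
  qed
  then obtain d rs where "hahn d" "\<forall>r\<in>set rs. hahn r" "splits_as (map cplx P) d rs"
    and count: "\<And>i j l. newton_edge P i j \<Longrightarrow> l = - newton_slope P i j \<Longrightarrow>
        length (filter (\<lambda>r. lead_root r l (\<lambda>z. Im z = 0 \<and> 0 < Re z)) rs) = tmult p (TFin Pos l) \<and>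
        length (filter (\<lambda>r. lead_root r l (\<lambda>z. Im z = 0 \<and> Re z < 0)) rs) = tmult (tneg_var p) (TFin Pos l)"
    by blast
  then show ?thesis
  proof (intro exI[of _ P] exI[of _ d] exI[of _ rs] conjI)
    show "length P = length p" by (simp add: lenP n_def)
    show "\<forall>i<length P. hahn (P ! i) \<and> vR (P ! i) = p ! i" using vP by (simp add: lenP)
  qed (simp_all add: Let_def count[OF _ refl])
qed

end
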